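(* Let $G=(V,E)$ be a finite connected graph with $|V|\ge 3$ (equivalently $|E|\ge 2$), and fix a starting vertex $x_0\in V$. For every $\delta>0$, the empirical measure process $(L^n)_{n\ge 1}$ of the $\delta$-once-reinforced random walk on $G$ started at $x_0$ satisfies a large deviation principle with a good rate function $I_\delta:\mathscr{P}(V)\to[0,\infty]$. Moreover: (1) for every $\nu\in\mathscr{P}(V)$, the function $\delta\mapsto I_\delta(\nu)$ is continuous and decreasing (i.e. $I_{\delta_1}(\nu)\ge I_{\delta_2}(\nu)$ for $1\le\delta_1<\delta_2$) on $[1,\infty)$, and constant on $(0,1]$; (2) for some $\nu\in\mathscr{P}(V)$, $\delta\mapsto I_\delta(\nu)$ is not differentiable at $\delta=1$; (3) for all $1\le\delta_1<\delta_2$, $I_{\delta_1}\ne I_{\delta_2}$.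
   Context: Graphs are undirected and simple; an edge is a set $uv=\{u,v\}$ and $u\sim v$ means that $u,v$ are adjacent. For $\delta>0$, the $\delta$-once-reinforced random walk ($\delta$-ORRW) on $G$ started at $x_0$ is the $V$-valued process $(X_n)_{n\ge 0}$ with $X_0=x_0$ and, with $\mathscr{F}_n=\sigma(X_0,\dots,X_n)$, $$\mathbb{P}(X_{n+1}=u\mid X_n=v,\mathscr{F}_n)=\frac{w_n(uv)}{\sum_{u'\sim v}w_n(u'v)}\ \text{ if } u\sim v,\qquad 0\text{ otherwise},$$ where $w_n(e)=\delta$ if $e\in\{X_iX_{i+1}: 0\le i<n\}$ and $w_n(e)=1$ otherwise. Its empirical measures are $L^n=\frac1n\sum_{i=0}^{n-1}\delta_{X_i}$, $n\ge1$, where $\delta_x$ is the Dirac mass at $x$. $\mathscr{P}(V)$ is the set of probability measures on $V$ with the weak convergence topology. A good rate function on a Polish space $\mathscr{X}$ is a lower semicontinuous $I:\mathscr{X}\to[0,\infty]$ with compact level sets $\{I\le M\}$ for all $M>0$ and with $I(x)<\infty$ for some $x$. A sequence $(\xi_n)$ of $\mathscr{X}$-valued random variables satisfies the large deviation principle (LDP) with rate function $I$ if $\limsup_n\frac1n\log\mathbb{P}(\xi_n\in C)\le-\inf_C I$ for every closed $C$ and $\liminf_n\frac1n\log\mathbb{P}(\xi_n\in O)\ge-\inf_O I$ for every open $O$. *)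

theory Defs
  imports "HOL-Probability.Probability"
begin

text \<open>Finite simple graphs: the vertex set is the whole of a finite type, the graph is its edge set.\<close>

definition simple_graph :: "'v set set \<Rightarrow> bool" where
  "simple_graph E \<longleftrightarrow> (\<forall>e\<in>E. \<exists>u v. u \<noteq> v \<and> e = {u, v})"

definition adjacent :: "'v set set \<Rightarrow> 'v \<Rightarrow> 'v \<Rightarrow> bool" where
  "adjacent E u v \<longleftrightarrow> {u, v} \<in> E"

definition connected_graph :: "'v set set \<Rightarrow> bool" where
  "connected_graph E \<longleftrightarrow> (\<forall>u v. (adjacent E)\<^sup>*\<^sup>* u v)"

definition orrw_weight :: "real \<Rightarrow> (nat \<Rightarrow> 'v) \<Rightarrow> nat \<Rightarrow> 'v set \<Rightarrow> real" where
  "orrw_weight \<delta> x n e = (if \<exists>i<n. e = {x i, x (Suc i)} then \<delta> else 1)"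

definition orrw_step :: "'v::finite set set \<Rightarrow> real \<Rightarrow> (nat \<Rightarrow> 'v) \<Rightarrow> nat \<Rightarrow> 'v \<Rightarrow> real" where
  "orrw_step E \<delta> x n u =
     (if adjacent E (x n) u
      then orrw_weight \<delta> x n {x n, u} / (\<Sum>u' | adjacent E (x n) u'. orrw_weight \<delta> x n {x n, u'})
      else 0)"

text \<open>\<open>history M X n\<close> is the sigma-algebra generated by \<open>X 0, \<dots>, X n\<close>.\<close>

definition history :: "'m measure \<Rightarrow> (nat \<Rightarrow> 'm \<Rightarrow> 'v) \<Rightarrow> nat \<Rightarrow> 'm measure" where
  "history M X n = sigma (space M) {X i -` A \<inter> space M | i A. i \<le> n}"

definition orrw :: "'v::finite set set \<Rightarrow> real \<Rightarrow> 'v \<Rightarrow> 'm measure \<Rightarrow> (nat \<Rightarrow> 'm \<Rightarrow> 'v) \<Rightarrow> bool" where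
  "orrw E \<delta> x0 M X \<longleftrightarrow>
     prob_space M \<and>
     (\<forall>n. X n \<in> measurable M (count_space UNIV)) \<and>
     (AE \<omega> in M. X 0 \<omega> = x0) \<and>
     (\<forall>n u. AE \<omega> in M.
        real_cond_exp M (history M X n) (indicator {\<omega> \<in> space M. X (Suc n) \<omega> = u}) \<omega>
          = orrw_step E \<delta> (\<lambda>i. X i \<omega>) n u)"

text \<open>
  The empirical measure of the first \<open>n\<close> positions is the image of the uniform distribution on the
  times \<open>{..<n}\<close>. It is meaningful only for \<open>n \<ge> 1\<close>.
\<close>

definition empirical_measure :: "(nat \<Rightarrow> 'm \<Rightarrow> 'v) \<Rightarrow> nat \<Rightarrow> 'm \<Rightarrow> 'v pmf" where
  "empirical_measure X n \<omega> = map_pmf (\<lambda>i. X i \<omega>) (pmf_of_set {..<n})"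

text \<open>
  The weak topology on the probability measures on a discrete space, where every function is
  continuous: the coarsest one making all integrals of bounded functions continuous.
\<close>

definition weak_topology :: "'v pmf topology" where
  "weak_topology = topology_generated_by
     {{p. measure_pmf.expectation p f \<in> U} | (f :: 'v \<Rightarrow> real) U. bounded (range f) \<and> open U}"

definition lower_semicontinuous :: "'x topology \<Rightarrow> ('x \<Rightarrow> ereal) \<Rightarrow> bool" where
  "lower_semicontinuous T I \<longleftrightarrow> (\<forall>a. openin T {x \<in> topspace T. a < I x})"

definition good_rate_function :: "'x topology \<Rightarrow> ('x \<Rightarrow> ereal) \<Rightarrow> bool" where
  "good_rate_function T I \<longleftrightarrow>
     (\<forall>x\<in>topspace T. 0 \<le> I x) \<and>
     lower_semicontinuous T I \<and>
     (\<forall>a::real. 0 < a \<longrightarrow> compactin T {x \<in> topspace T. I x \<le> ereal a}) \<and>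
     (\<exists>x\<in>topspace T. I x < \<infinity>)"

definition scaled_log_prob :: "'m measure \<Rightarrow> nat \<Rightarrow> 'm set \<Rightarrow> ereal" where
  "scaled_log_prob M n A =
     (if measure M A = 0 then -\<infinity> else ereal (ln (measure M A) / real n))"

text \<open>
  The infimum over the empty set is \<open>\<infinity>\<close> in \<^typ>\<open>ereal\<close>. The sequence is indexed by
  \<open>n \<ge> 1\<close>; its value at \<open>0\<close> is irrelevant.
\<close>

definition satisfies_LDP ::
  "'x topology \<Rightarrow> 'm measure \<Rightarrow> (nat \<Rightarrow> 'm \<Rightarrow> 'x) \<Rightarrow> ('x \<Rightarrow> ereal) \<Rightarrow> bool" where
  "satisfies_LDP T M \<xi> I \<longleftrightarrow>
     (\<forall>n\<ge>1. \<xi> n \<in> measurable M (sigma (topspace T) {U. openin T U})) \<and>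
     (\<forall>C. closedin T C \<longrightarrow>
        limsup (\<lambda>n. scaled_log_prob M n {\<omega> \<in> space M. \<xi> n \<omega> \<in> C}) \<le> - (INF x\<in>C. I x)) \<and>
     (\<forall>U. openin T U \<longrightarrow>
        liminf (\<lambda>n. scaled_log_prob M n {\<omega> \<in> space M. \<xi> n \<omega> \<in> U}) \<ge> - (INF x\<in>U. I x))"

end

theory Submission
  imports Defs "HOL-Real_Asymp.Real_Asymp"
begin

text \<open>
  The pair (traversed edges, position) is a Markov chain, so the probability that the first \<open>n\<close>
  departure points form a given multiset \<open>c\<close> obeys a recursion. Its key property is a power bound: if
  \<open>c\<close> has probability \<open>w\<close>, then some multiset close to \<open>q c\<close> has probability at least
  \<open>w ^ q\<close> up to a factor \<open>(C (n + 1) ^ C) ^ q\<close>. To see this, fix the phases between first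
  traversals of edges; within one phase the walk runs back and forth over an undirected graph, so
  \<open>q\<close> copies of the phase can be strung together by returning to its starting point. Since there are
  only polynomially many multisets of size \<open>n\<close>, this makes the local upper and lower exponential rates
  of the empirical measure coincide, and compactness of the simplex turns this into the large deviation
  principle.

  No formula for the rate function is needed for its dependence on \<open>\<delta>\<close>. Along a path the
  probabilities for \<open>\<delta>1 \<le> \<delta>2\<close> compare step by step, with a loss only at the finitely many
  first traversals in one direction and a loss of \<open>\<delta>2 / \<delta>1\<close> per step in the other; for
  \<open>\<delta> \<le> 1\<close> the walk may first cover the whole graph, after which it is a simple random walk. The
  uniform measure on an edge at \<open>x0\<close> has an explicit rate, which is strictly decreasing on
  \<open>[1, \<infinity>)\<close> with nonzero right derivative at 1.
\<close>

text \<open>The usual route, supermultiplicativity and Fekete's lemma, is blocked: a second piece of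
  the walk starts from more traversed edges than the first, so occupation probabilities from the
  empty edge set cannot simply be multiplied. What helps is that the traversed set only grows, hence
  changes boundedly often, and that the copies need not repeat a first traversal: its probability
  \<open>p\<close> satisfies \<open>p ^ q \<le> p\<close>. The multiset so produced is off by a
  bounded amount per copy, that is by \<open>q * L\<close> against a total of
  \<open>q * size c\<close>. The relative error \<open>L / size c\<close> does not depend on
  \<open>q\<close>, so a long \<open>c\<close> is fixed first and only then \<open>q\<close> grows;
  the polynomial factor costs a multiple of \<open>ln n / n\<close> per step and disappears in the
  same way. Multisets replace single paths because the number of paths is exponential and would
  enter the rate.\<close>

section \<open>Transition and occupation probabilities\<close>

text \<open>\<open>A\<close> is the set of edges traversed so far.\<close>

definition trans_prob :: "'v::finite set set \<Rightarrow> real \<Rightarrow> 'v set set \<Rightarrow> 'v \<Rightarrow> 'v \<Rightarrow> real" where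
  "trans_prob E \<delta> A x y =
     (if adjacent E x y
      then (if {x, y} \<in> A then \<delta> else 1) / (\<Sum>u | adjacent E x u. if {x, u} \<in> A then \<delta> else 1)
      else 0)"

text \<open>
  \<open>occ_prob E \<delta> n A x c\<close>: starting at \<open>x\<close> with the edges \<open>A\<close> already traversed, the multiset of
  the next \<open>n\<close> positions, counting \<open>x\<close> but not the position after the last step, is \<open>c\<close>. In
  \<open>stay_prob\<close> the walk uses only edges of \<open>A\<close> and ends in \<open>t\<close>.
\<close>

fun occ_prob :: "'v::finite set set \<Rightarrow> real \<Rightarrow> nat \<Rightarrow> 'v set set \<Rightarrow> 'v \<Rightarrow> 'v multiset \<Rightarrow> real" where
  "occ_prob E \<delta> 0 A x c = (if c = {#} then 1 else 0)"
| "occ_prob E \<delta> (Suc n) A x c =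
     (if x \<in># c
      then \<Sum>y\<in>UNIV. trans_prob E \<delta> A x y * occ_prob E \<delta> n (insert {x, y} A) y (c - {#x#})
      else 0)"

fun stay_prob :: "'v::finite set set \<Rightarrow> real \<Rightarrow> 'v set set \<Rightarrow> nat \<Rightarrow> 'v \<Rightarrow> 'v \<Rightarrow> 'v multiset \<Rightarrow> real" where
  "stay_prob E \<delta> A 0 x t c = (if c = {#} \<and> x = t then 1 else 0)"
| "stay_prob E \<delta> A (Suc n) x t c =
     (if x \<in># c
      then \<Sum>y\<in>{y. {x, y} \<in> A}. trans_prob E \<delta> A x y * stay_prob E \<delta> A n y t (c - {#x#})
      else 0)"

section \<open>Elementary bounds, concatenation and reversal of walks\<close>

lemma trans_denom_pos:
  fixes E :: "'v::finite set set"
  assumes "\<delta> > 0" "adjacent E x y"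
  shows "(\<Sum>u | adjacent E x u. if {x, u} \<in> A then \<delta> else (1::real)) > 0"
proof (rule sum_pos)
  show "finite {u. adjacent E x u}" by (rule finite)
qed (use assms in auto)

lemma trans_prob_nonneg: "\<delta> > 0 \<Longrightarrow> 0 \<le> trans_prob E \<delta> A x y"
  unfolding trans_prob_def by (auto intro!: divide_nonneg_nonneg sum_nonneg)

lemma trans_prob_pos: "\<delta> > 0 \<Longrightarrow> adjacent E x y \<Longrightarrow> 0 < trans_prob E \<delta> A x y"
  using trans_denom_pos[of \<delta> E x y A] unfolding trans_prob_def by auto

lemma adjacent_commute: "adjacent E x y \<longleftrightarrow> adjacent E y x"
  by (simp add: adjacent_def insert_commute)

lemma trans_prob_eq_0: "\<not> adjacent E x y \<Longrightarrow> trans_prob E \<delta> A x y = 0"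
  by (simp add: trans_prob_def)

lemma sum_trans_prob_le:
  assumes "\<delta> > 0"
  shows "(\<Sum>y\<in>UNIV. trans_prob E \<delta> A x y) \<le> 1"
proof -
  let ?D = "\<Sum>u | adjacent E x u. if {x, u} \<in> A then \<delta> else (1::real)"
  have "(\<Sum>y\<in>UNIV. trans_prob E \<delta> A x y) = (\<Sum>y | adjacent E x y. trans_prob E \<delta> A x y)"
    by (rule sum.mono_neutral_right) (auto simp: trans_prob_def)
  also have "\<dots> = (\<Sum>y | adjacent E x y. (if {x, y} \<in> A then \<delta> else 1) / ?D)"
    by (intro sum.cong) (auto simp: trans_prob_def)
  also have "\<dots> = ?D / ?D" by (rule sum_divide_distrib[symmetric])
  \<comment> \<open>Not always an equality: at a vertex without neighbours the denominator is an
    empty sum and \<open>0 / 0 = 0\<close>.\<close>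
  finally show ?thesis by (metis div_by_0 divide_self order_refl zero_le_one)
qed

lemma trans_prob_le_1: "\<delta> > 0 \<Longrightarrow> trans_prob E \<delta> A x y \<le> 1"
  using sum_trans_prob_le[of \<delta> E A x] member_le_sum[of y UNIV "trans_prob E \<delta> A x"]
  by (auto simp: trans_prob_nonneg intro: order_trans)

lemma occ_prob_nonneg: "\<delta> > 0 \<Longrightarrow> 0 \<le> occ_prob E \<delta> n A x c"
  by (induction n arbitrary: A x c) (auto intro!: sum_nonneg mult_nonneg_nonneg trans_prob_nonneg)

lemma stay_prob_nonneg: "\<delta> > 0 \<Longrightarrow> 0 \<le> stay_prob E \<delta> A n x t c"
  by (induction n arbitrary: x c) (auto intro!: sum_nonneg mult_nonneg_nonneg trans_prob_nonneg)

lemma occ_prob_le_1: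
  assumes "\<delta> > 0"
  shows "occ_prob E \<delta> n A x c \<le> 1"
proof (induction n arbitrary: A x c)
  case (Suc n)
  have "(\<Sum>y\<in>UNIV. trans_prob E \<delta> A x y * occ_prob E \<delta> n (insert {x, y} A) y (c - {#x#}))
      \<le> (\<Sum>y\<in>UNIV. trans_prob E \<delta> A x y * 1)"
    using Suc assms by (intro sum_mono mult_left_mono trans_prob_nonneg) auto
  also have "\<dots> \<le> 1" using sum_trans_prob_le[OF assms] by simp
  finally show ?case by simp
qed simp

lemma occ_prob_step:
  assumes "\<delta> > 0"
  shows "trans_prob E \<delta> A x y * occ_prob E \<delta> n (insert {x, y} A) y c
    \<le> occ_prob E \<delta> (Suc n) A x (add_mset x c)"
proof -
  have "trans_prob E \<delta> A x y * occ_prob E \<delta> n (insert {x, y} A) y c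
     \<le> (\<Sum>y\<in>UNIV. trans_prob E \<delta> A x y * occ_prob E \<delta> n (insert {x, y} A) y c)"
    by (rule member_le_sum) (auto simp: assms trans_prob_nonneg occ_prob_nonneg)
  then show ?thesis by simp
qed

lemma stay_prob_step:
  assumes "\<delta> > 0" "{x, y} \<in> A"
  shows "trans_prob E \<delta> A x y * stay_prob E \<delta> A n y t c \<le> stay_prob E \<delta> A (Suc n) x t (add_mset x c)"
proof -
  have "trans_prob E \<delta> A x y * stay_prob E \<delta> A n y t c
     \<le> (\<Sum>y\<in>{y. {x, y} \<in> A}. trans_prob E \<delta> A x y * stay_prob E \<delta> A n y t c)"
    by (rule member_le_sum) (auto simp: assms trans_prob_nonneg stay_prob_nonneg)
  then show ?thesis by simp
qed

text \<open>Only an inequality, because the right side also counts other midpoints and other ways to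
  divide \<open>c + d\<close> between the two pieces.\<close>

lemma stay_prob_concat:
  assumes "\<delta> > 0"
  shows "stay_prob E \<delta> A n x u c * stay_prob E \<delta> A m u t d \<le> stay_prob E \<delta> A (n + m) x t (c + d)"
proof (induction n arbitrary: x c)
  case 0
  then show ?case by (auto simp: stay_prob_nonneg assms)
next
  case (Suc n)
  show ?case
  proof (cases "x \<in># c")
    case True
    have "stay_prob E \<delta> A (Suc n) x u c * stay_prob E \<delta> A m u t d =
      (\<Sum>y\<in>{y. {x, y} \<in> A}. trans_prob E \<delta> A x y * (stay_prob E \<delta> A n y u (c - {#x#}) * stay_prob E \<delta> A m u t d))"
      using True by (simp add: sum_distrib_right mult.assoc)
    also have "\<dots> \<le> (\<Sum>y\<in>{y. {x, y} \<in> A}. trans_prob E \<delta> A x y * stay_prob E \<delta> A (n + m) y t (c - {#x#} + d))"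
      by (intro sum_mono mult_left_mono Suc trans_prob_nonneg assms)
    also have "\<dots> = stay_prob E \<delta> A (Suc n + m) x t (c + d)"
      using True by simp
    finally show ?thesis .
  qed (use stay_prob_nonneg[OF assms, of E A "Suc n + m"] in \<open>simp del: stay_prob.simps(2) add: stay_prob.simps(2)[of _ _ _ n]\<close>)
qed

text \<open>A walk that uses only edges of \<open>A\<close> leaves the traversed set unchanged, so
  the continuation starts from \<open>A\<close> itself.\<close>

lemma stay_occ_prob_concat:
  assumes "\<delta> > 0"
  shows "stay_prob E \<delta> A n x t c * occ_prob E \<delta> m A t d \<le> occ_prob E \<delta> (n + m) A x (c + d)"
proof (induction n arbitrary: x c)
  case 0
  then show ?case by (auto simp: occ_prob_nonneg assms)
next
  case (Suc n)
  show ?case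
  proof (cases "x \<in># c")
    case True
    have "stay_prob E \<delta> A (Suc n) x t c * occ_prob E \<delta> m A t d =
      (\<Sum>y\<in>{y. {x, y} \<in> A}. trans_prob E \<delta> A x y * (stay_prob E \<delta> A n y t (c - {#x#}) * occ_prob E \<delta> m A t d))"
      using True by (simp add: sum_distrib_right mult.assoc)
    also have "\<dots> \<le> (\<Sum>y\<in>{y. {x, y} \<in> A}. trans_prob E \<delta> A x y * occ_prob E \<delta> (n + m) (insert {x, y} A) y (c - {#x#} + d))"
      by (intro sum_mono mult_left_mono trans_prob_nonneg assms) (use Suc in \<open>auto simp: insert_absorb\<close>)
    also have "\<dots> \<le> (\<Sum>y\<in>UNIV. trans_prob E \<delta> A x y * occ_prob E \<delta> (n + m) (insert {x, y} A) y (c - {#x#} + d))"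
      by (intro sum_mono2) (auto simp: assms trans_prob_nonneg occ_prob_nonneg)
    also have "\<dots> = occ_prob E \<delta> (Suc n + m) A x (c + d)"
      using True by simp
    finally show ?thesis .
  qed (use occ_prob_nonneg[OF assms, of E "Suc n + m"] in \<open>simp del: occ_prob.simps(2)\<close>)
qed

text \<open>The transition probabilities inside \<open>A\<close> are not symmetric, but their
  support is: every step can be undone with positive probability. Only departure points are counted,
  so the reversed walk has another multiset \<open>d\<close>.\<close>

lemma stay_prob_reverse:
  assumes "\<delta> > 0"
  shows "stay_prob E \<delta> A n x t c > 0 \<Longrightarrow> \<exists>d. stay_prob E \<delta> A (size d) t x d > 0"
proof (induction n arbitrary: x c)
  case 0
  then show ?case by (intro exI[of _ "{#}"]) (auto split: if_splits)
next
  case (Suc n)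
  then have x: "x \<in># c" by (auto split: if_splits)
  with Suc.prems obtain y where y: "{x, y} \<in> A"
      "trans_prob E \<delta> A x y * stay_prob E \<delta> A n y t (c - {#x#}) \<noteq> 0"
    by (auto dest!: less_imp_neq[THEN not_sym] elim!: sum.not_neutral_contains_not_neutral)
  then have "stay_prob E \<delta> A n y t (c - {#x#}) > 0"
    using stay_prob_nonneg[OF assms, of E A n y t "c - {#x#}"] by auto
  from Suc.IH[OF this] obtain d where d: "stay_prob E \<delta> A (size d) t y d > 0" by blast
  have "adjacent E y x" using y trans_prob_eq_0 adjacent_commute by fastforce
  then have p: "trans_prob E \<delta> A y x > 0" by (rule trans_prob_pos[OF assms])
  have "0 < trans_prob E \<delta> A y x * stay_prob E \<delta> A 0 x x {#}" using p by simp
  also have "\<dots> \<le> stay_prob E \<delta> A (Suc 0) y x {#y#}"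
    using y by (intro stay_prob_step assms) (simp add: insert_commute)
  finally have "0 < stay_prob E \<delta> A (size d) t y d * stay_prob E \<delta> A (Suc 0) y x {#y#}"
    using d by simp
  also have "\<dots> \<le> stay_prob E \<delta> A (size d + Suc 0) t x (d + {#y#})"
    by (rule stay_prob_concat[OF assms])
  finally show ?case by (intro exI[of _ "d + {#y#}"]) simp
qed

section \<open>Splitting a walk at its first edge outside the traversed set\<close>

lemma finite_multisets_size_le: "finite {c :: 'v::finite multiset. size c \<le> n}"
  and card_multisets_size_le: "card {c :: 'v::finite multiset. size c \<le> n} \<le> (n + 1) ^ CARD('v)"
proof -
  let ?S = "{c :: 'v multiset. size c \<le> n}" and ?P = "PiE (UNIV :: 'v set) (\<lambda>_. {..n})"
  have inj: "inj_on count ?S" by (auto intro: inj_onI simp: count_inject)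
  have sub: "count ` ?S \<subseteq> ?P"
    by (auto simp: PiE_def extensional_def intro: order_trans[OF count_le_size])
  have fin: "finite ?P" by (intro finite_PiE) auto
  from finite_subset[OF sub fin] show "finite ?S" using inj by (rule finite_imageD)
  have "card ?S = card (count ` ?S)" using inj by (rule card_image[symmetric])
  also have "\<dots> \<le> card ?P" using fin sub by (rule card_mono)
  also have "\<dots> = (n + 1) ^ CARD('v)" by (simp add: card_PiE)
  finally show "card ?S \<le> (n + 1) ^ CARD('v)" .
qed

text \<open>
  The contribution to \<open>occ_prob E \<delta> n A x c\<close> of the walks whose first edge outside \<open>A\<close> is
  \<open>{t, y}\<close> and which visit \<open>d\<close> before they cross it.
\<close>

definition exit_term ::
  "'v::finite set set \<Rightarrow> real \<Rightarrow> nat \<Rightarrow> 'v set set \<Rightarrow> 'v \<Rightarrow> 'v multiset \<Rightarrow> 'v multiset \<Rightarrow> 'v \<Rightarrow> 'v \<Rightarrow> real" where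
  "exit_term E \<delta> n A x c d t y =
     (if {t, y} \<notin> A \<and> add_mset t d \<subseteq># c
      then stay_prob E \<delta> A (size d) x t d * trans_prob E \<delta> A t y *
           occ_prob E \<delta> (n - size d - 1) (insert {t, y} A) y (c - add_mset t d)
      else 0)"

lemma exit_term_nonneg: "\<delta> > 0 \<Longrightarrow> 0 \<le> exit_term E \<delta> n A x c d t y"
  by (simp add: exit_term_def stay_prob_nonneg trans_prob_nonneg occ_prob_nonneg)

text \<open>If the walk makes a step before it exits, that step stays inside \<open>A\<close>, so
  exit terms obey a first-step recursion. An immediate exit, with \<open>{#}\<close> in place of
  \<open>add_mset x d\<close>, is the remaining case.\<close>

lemma exit_term_Suc:
  assumes "x \<in># c"
  shows "exit_term E \<delta> (Suc n) A x c (add_mset x d) t z =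
    (\<Sum>y\<in>{y. {x, y} \<in> A}. trans_prob E \<delta> A x y * exit_term E \<delta> n A y (c - {#x#}) d t z)"
proof -
  obtain c' where c: "c = add_mset x c'" using assms by (metis mset_add)
  have "add_mset t (add_mset x d) \<subseteq># c \<longleftrightarrow> add_mset t d \<subseteq># c'"
    unfolding c by (subst add_mset_commute) simp
  moreover have "c - add_mset t (add_mset x d) = c' - add_mset t d"
    unfolding c by (subst add_mset_commute) simp
  ultimately show ?thesis
    by (simp add: exit_term_def c sum_distrib_right sum_distrib_left mult.assoc)
qed

lemma sum_rotate4:
  "(\<Sum>y\<in>B. \<Sum>d\<in>M. \<Sum>t\<in>S. \<Sum>z\<in>T. f y d t z) = (\<Sum>d\<in>M. \<Sum>t\<in>S. \<Sum>z\<in>T. \<Sum>y\<in>B. f y d t z)"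
proof -
  have "(\<Sum>y\<in>B. \<Sum>d\<in>M. \<Sum>t\<in>S. \<Sum>z\<in>T. f y d t z) = (\<Sum>d\<in>M. \<Sum>y\<in>B. \<Sum>t\<in>S. \<Sum>z\<in>T. f y d t z)"
    by (rule sum.swap)
  also have "\<dots> = (\<Sum>d\<in>M. \<Sum>t\<in>S. \<Sum>y\<in>B. \<Sum>z\<in>T. f y d t z)"
    by (rule sum.cong[OF refl], rule sum.swap)
  also have "\<dots> = (\<Sum>d\<in>M. \<Sum>t\<in>S. \<Sum>z\<in>T. \<Sum>y\<in>B. f y d t z)"
    by (rule sum.cong[OF refl], rule sum.cong[OF refl], rule sum.swap)
  finally show ?thesis .
qed

text \<open>Either the walk never leaves \<open>A\<close> or it has a first exit. In the induction,
  a first step inside \<open>A\<close> turns \<open>d\<close> into \<open>add_mset x d\<close>, and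
  a first step outside \<open>A\<close> is the term with \<open>d = {#}\<close>; no exit term is
  counted twice.\<close>

lemma occ_prob_decompose:
  assumes "\<delta> > 0"
  shows "occ_prob E \<delta> n A x c \<le> (\<Sum>t\<in>UNIV. stay_prob E \<delta> A n x t c)
    + (\<Sum>d | size d \<le> n. \<Sum>t\<in>UNIV. \<Sum>y\<in>UNIV. exit_term E \<delta> n A x c d t y)"
proof (induction n arbitrary: x c)
  case 0
  have "(if c = {#} then 1 else 0) \<le> (\<Sum>t\<in>UNIV. stay_prob E \<delta> A 0 x t c)"
    using member_le_sum[of x UNIV "\<lambda>t. stay_prob E \<delta> A 0 x t c"] by auto
  moreover have "0 \<le> (\<Sum>d | size d \<le> 0. \<Sum>t\<in>UNIV. \<Sum>y\<in>UNIV. exit_term E \<delta> 0 A x c d t y)"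
    using assms by (intro sum_nonneg exit_term_nonneg)
  ultimately show ?case by (simp del: stay_prob.simps)
next
  case (Suc n)
  show ?case
  proof (cases "x \<in># c")
    case False
    have "0 \<le> (\<Sum>t\<in>UNIV. stay_prob E \<delta> A (Suc n) x t c)"
      using assms by (intro sum_nonneg stay_prob_nonneg)
    moreover have "0 \<le> (\<Sum>d | size d \<le> Suc n. \<Sum>t\<in>UNIV. \<Sum>y\<in>UNIV. exit_term E \<delta> (Suc n) A x c d t y)"
      using assms by (intro sum_nonneg exit_term_nonneg)
    ultimately show ?thesis using False by simp
  next
    case True
    let ?p = "trans_prob E \<delta> A x" and ?c = "c - {#x#}" and ?B = "{y. {x, y} \<in> A}"
    let ?G = "\<lambda>d. \<Sum>t\<in>UNIV. \<Sum>y\<in>UNIV. exit_term E \<delta> (Suc n) A x c d t y"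
    let ?M = "\<lambda>n. {d :: 'a multiset. size d \<le> n}"
    have "occ_prob E \<delta> (Suc n) A x c = (\<Sum>y\<in>UNIV. ?p y * occ_prob E \<delta> n (insert {x, y} A) y ?c)"
      using True by simp
    also have "\<dots> = (\<Sum>y\<in>?B. ?p y * occ_prob E \<delta> n (insert {x, y} A) y ?c)
        + (\<Sum>y\<in>-?B. ?p y * occ_prob E \<delta> n (insert {x, y} A) y ?c)"
      by (subst sum.union_disjoint[symmetric]) (auto intro!: sum.cong)
    also have "(\<Sum>y\<in>?B. ?p y * occ_prob E \<delta> n (insert {x, y} A) y ?c) \<le>
      (\<Sum>y\<in>?B. ?p y * ((\<Sum>t\<in>UNIV. stay_prob E \<delta> A n y t ?c)
         + (\<Sum>d\<in>?M n. \<Sum>t\<in>UNIV. \<Sum>z\<in>UNIV. exit_term E \<delta> n A y ?c d t z)))"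
      by (intro sum_mono mult_left_mono trans_prob_nonneg assms) (use Suc in \<open>auto simp: insert_absorb\<close>)
    also have "\<dots> = (\<Sum>y\<in>?B. \<Sum>t\<in>UNIV. ?p y * stay_prob E \<delta> A n y t ?c)
         + (\<Sum>y\<in>?B. \<Sum>d\<in>?M n. \<Sum>t\<in>UNIV. \<Sum>z\<in>UNIV. ?p y * exit_term E \<delta> n A y ?c d t z)"
      by (simp add: distrib_left sum.distrib sum_distrib_left)
    also have "(\<Sum>y\<in>?B. \<Sum>t\<in>UNIV. ?p y * stay_prob E \<delta> A n y t ?c) = (\<Sum>t\<in>UNIV. stay_prob E \<delta> A (Suc n) x t c)"
      using True by (subst sum.swap) simp
    also have "(\<Sum>y\<in>?B. \<Sum>d\<in>?M n. \<Sum>t\<in>UNIV. \<Sum>z\<in>UNIV. ?p y * exit_term E \<delta> n A y ?c d t z)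
       = (\<Sum>d\<in>?M n. \<Sum>t\<in>UNIV. \<Sum>z\<in>UNIV. \<Sum>y\<in>?B. ?p y * exit_term E \<delta> n A y ?c d t z)"
      by (rule sum_rotate4)
    also have "\<dots> = (\<Sum>d\<in>?M n. ?G (add_mset x d))"
      by (simp add: exit_term_Suc[OF True])
    also have "\<dots> = (\<Sum>d\<in>add_mset x ` ?M n. ?G d)"
      by (subst sum.reindex) (auto intro: inj_onI)
    also have "(\<Sum>y\<in>-?B. ?p y * occ_prob E \<delta> n (insert {x, y} A) y ?c)
        = (\<Sum>y\<in>-?B. exit_term E \<delta> (Suc n) A x c {#} x y)"
      using True by (intro sum.cong) (auto simp: exit_term_def)
    also have "\<dots> \<le> (\<Sum>y\<in>UNIV. exit_term E \<delta> (Suc n) A x c {#} x y)"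
      by (intro sum_mono2) (auto simp: exit_term_nonneg assms)
    also have "\<dots> \<le> ?G {#}"
      by (rule member_le_sum[where f = "\<lambda>t. \<Sum>y\<in>UNIV. exit_term E \<delta> (Suc n) A x c {#} t y"])
        (auto intro!: sum_nonneg simp: exit_term_nonneg assms)
    finally have "occ_prob E \<delta> (Suc n) A x c \<le> (\<Sum>t\<in>UNIV. stay_prob E \<delta> A (Suc n) x t c)
        + ((\<Sum>d\<in>add_mset x ` ?M n. ?G d) + ?G {#})" by simp
    also have "(\<Sum>d\<in>add_mset x ` ?M n. ?G d) + ?G {#} = (\<Sum>d\<in>insert {#} (add_mset x ` ?M n). ?G d)"
      by (subst sum.insert) (auto simp: finite_multisets_size_le)
    also have "\<dots> \<le> (\<Sum>d\<in>?M (Suc n). ?G d)"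
      by (intro sum_mono2 finite_multisets_size_le) (auto intro!: sum_nonneg exit_term_nonneg assms)
    finally show ?thesis by simp
  qed
qed

lemma exists_large_summand:
  fixes f :: "'a \<Rightarrow> real"
  assumes "finite S" "S \<noteq> {}"
  obtains s where "s \<in> S" "sum f S \<le> card S * f s"
proof -
  have fin: "finite (f ` S)" "f ` S \<noteq> {}" using assms by auto
  then obtain s where s: "s \<in> S" "f s = Max (f ` S)" by (metis Max_in imageE)
  then have "\<And>t. t \<in> S \<Longrightarrow> f t \<le> f s" using fin by simp
  then show ?thesis using that[OF s(1)] sum_bounded_above[of S f "f s"] by simp
qed

text \<open>Pigeonhole over the decomposition: 2 for the choice between staying and leaving, the
  rest for the number of end points \<open>t\<close> or of triples \<open>(d, t, y)\<close>.
  Polynomially many terms cost nothing on the exponential scale.\<close>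

lemma occ_prob_large_term:
  fixes A :: "'v::finite set set"
  assumes "\<delta> > 0"
  shows "(\<exists>t. occ_prob E \<delta> n A x c \<le> 2 * CARD('v) * stay_prob E \<delta> A n x t c) \<or>
    (\<exists>d t y. size d \<le> n \<and>
      occ_prob E \<delta> n A x c \<le> 2 * ((n + 1) ^ CARD('v) * CARD('v) ^ 2) * exit_term E \<delta> n A x c d t y)"
proof -
  let ?M = "{d :: 'v multiset. size d \<le> n}"
  let ?S = "\<Sum>t\<in>UNIV. stay_prob E \<delta> A n x t c"
  let ?T = "\<Sum>d\<in>?M. \<Sum>t\<in>UNIV. \<Sum>y\<in>UNIV. exit_term E \<delta> n A x c d t y"
  have le: "occ_prob E \<delta> n A x c \<le> ?S + ?T" by (rule occ_prob_decompose[OF assms])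
  show ?thesis
  proof (cases "?T \<le> ?S")
    case True
    obtain t where "?S \<le> CARD('v) * stay_prob E \<delta> A n x t c"
      by (rule exists_large_summand[of "UNIV :: 'v set"]) auto
    then have "occ_prob E \<delta> n A x c \<le> 2 * CARD('v) * stay_prob E \<delta> A n x t c"
      using le True by simp
    then show ?thesis by blast
  next
    case False
    let ?I = "?M \<times> (UNIV :: 'v set) \<times> (UNIV :: 'v set)"
    have fin: "finite ?I" by (simp add: finite_multisets_size_le)
    have T: "?T = (\<Sum>(d, t, y)\<in>?I. exit_term E \<delta> n A x c d t y)"
      by (simp add: sum.cartesian_product finite_multisets_size_le)
    have "({#}, x, x) \<in> ?I" by simp
    then have ne: "?I \<noteq> {}" by blast
    obtain i where i: "i \<in> ?I" "?T \<le> card ?I * (case i of (d, t, y) \<Rightarrow> exit_term E \<delta> n A x c d t y)"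
      unfolding T by (rule exists_large_summand[OF fin ne])
    obtain d t y where [simp]: "i = (d, t, y)" by (cases i)
    have "real (card ?I) \<le> (n + 1) ^ CARD('v) * CARD('v) ^ 2"
    proof -
      have "card ?I = card ?M * CARD('v) ^ 2" by (simp add: card_cartesian_product power2_eq_square)
      also have "\<dots> \<le> (n + 1) ^ CARD('v) * CARD('v) ^ 2"
        by (intro mult_right_mono card_multisets_size_le) simp
      finally show ?thesis by (metis of_nat_le_iff of_nat_mult of_nat_power)
    qed
    then have "?T \<le> ((n + 1) ^ CARD('v) * CARD('v) ^ 2) * exit_term E \<delta> n A x c d t y"
      using i(2) exit_term_nonneg[OF assms, of E n A x c d t y]
      by (auto intro: order_trans mult_right_mono)
    then have "occ_prob E \<delta> n A x c
        \<le> 2 * ((n + 1) ^ CARD('v) * CARD('v) ^ 2) * exit_term E \<delta> n A x c d t y"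
      using le False by simp
    then show ?thesis using i(1) by auto
  qed
qed

section \<open>Replicating occupation vectors\<close>

lemma finite_uniform_bound:
  fixes P :: "'a \<Rightarrow> nat \<Rightarrow> bool"
  assumes "finite S" "\<And>a. a \<in> S \<Longrightarrow> \<exists>D. P a D" "\<And>a D D'. P a D \<Longrightarrow> D \<le> D' \<Longrightarrow> P a D'"
  shows "\<exists>D. \<forall>a\<in>S. P a D"
proof -
  obtain f where f: "\<And>a. a \<in> S \<Longrightarrow> P a (f a)" using assms(2) by metis
  have "P a (Max (f ` S))" if "a \<in> S" for a
    using assms(3)[OF f[OF that]] assms(1) that by simp
  then show ?thesis by blast
qed

text \<open>\<open>D\<close> bounds both the length of a return walk and the reciprocal of its
  probability. A return walk depends only on \<open>(A, x, t)\<close> and not on the walk that it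
  undoes, and there are finitely many such triples.\<close>

lemma return_walk_bound:
  fixes E :: "'v::finite set set"
  assumes "\<delta> > 0"
  obtains D :: nat where "D \<ge> 1" "\<And>A x t n c. stay_prob E \<delta> A n x t c > 0 \<Longrightarrow>
    \<exists>r. size r \<le> D \<and> 1 \<le> D * stay_prob E \<delta> A (size r) t x r"
proof -
  define P where "P = (\<lambda>(A, x, t) D. (\<exists>n c. stay_prob E \<delta> A n x t c > 0) \<longrightarrow>
    (\<exists>r. size r \<le> D \<and> 1 \<le> real D * stay_prob E \<delta> A (size r) t x r))"
  have ex: "\<exists>D. P i D" for i
  proof -
    obtain A x t where i: "i = (A, x, t)" by (cases i)
    show ?thesis
    proof (cases "\<exists>n c. stay_prob E \<delta> A n x t c > 0")
      case True
      then obtain r where r: "stay_prob E \<delta> A (size r) t x r > 0"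
        using stay_prob_reverse[OF assms] by blast
      obtain N :: nat where N: "1 / stay_prob E \<delta> A (size r) t x r \<le> N"
        using real_arch_simple by blast
      let ?D = "max N (size r)"
      have "1 \<le> real N * stay_prob E \<delta> A (size r) t x r" using N r by (simp add: field_simps)
      also have "\<dots> \<le> real ?D * stay_prob E \<delta> A (size r) t x r"
        using r by (intro mult_right_mono) auto
      finally have "size r \<le> ?D \<and> 1 \<le> real ?D * stay_prob E \<delta> A (size r) t x r" by simp
      then have "P i ?D" unfolding P_def i by blast
      then show ?thesis by blast
    qed (auto simp: P_def i)
  qed
  have mono: "P i D'" if "P i D" "D \<le> D'" for i D D'
  proof -
    have "1 \<le> real D' * s" if "1 \<le> real D * s" "0 \<le> s" for s
      using mult_right_mono[of "real D" "real D'" s] that \<open>D \<le> D'\<close> by linarith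
    then show ?thesis using that unfolding P_def
      by (clarsimp, meson le_trans stay_prob_nonneg[OF assms])
  qed
  have "\<exists>D. \<forall>i\<in>UNIV. P i D"
    by (rule finite_uniform_bound) (simp, rule ex, rule mono)
  then obtain D where D: "\<forall>i\<in>UNIV. P i D" by blast
  \<comment> \<open>The successor secures \<open>D \<ge> 1\<close>.\<close>
  have "P i (Suc D)" for i by (rule mono[OF D[rule_format, OF UNIV_I]]) simp
  then have "P (A, x, t) (Suc D)" for A x t by blast
  then show ?thesis using that[of "Suc D"] unfolding P_def split by (metis le_add1 plus_1_eq_Suc)
qed

text \<open>The runs of \<open>c\<close> go from \<open>x\<close> to \<open>t\<close> and are joined
  by return walks \<open>r\<close> from \<open>t\<close> to \<open>x\<close>; \<open>Suc k\<close>
  runs need only \<open>k\<close> returns, each costing at most a factor \<open>D\<close>.\<close>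

lemma stay_prob_power:
  fixes c :: "'v::finite multiset"
  assumes "\<delta> > 0" and D: "D \<ge> 0" "1 \<le> D * stay_prob E \<delta> A (size r) t x r"
  defines "C \<equiv> \<lambda>k. repeat_mset (Suc k) c + repeat_mset k r"
  shows "stay_prob E \<delta> A (size c) x t c ^ Suc k \<le> D ^ k * stay_prob E \<delta> A (size (C k)) x t (C k)"
proof (induction k)
  case 0
  then show ?case by (simp add: C_def)
next
  case (Suc k)
  let ?s = "stay_prob E \<delta> A (size c) x t c" and ?r = "stay_prob E \<delta> A (size r) t x r"
  let ?S = "\<lambda>k. stay_prob E \<delta> A (size (C k)) x t (C k)"
  have "?S k * ?r * ?s \<le> stay_prob E \<delta> A (size (C k) + size r) x x (C k + r) * ?s"
    by (intro mult_right_mono stay_prob_concat stay_prob_nonneg assms)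
  also have "\<dots> \<le> stay_prob E \<delta> A (size (C k) + size r + size c) x t (C k + r + c)"
    by (intro stay_prob_concat assms)
  also have "C k + r + c = C (Suc k)" by (simp add: C_def)
  finally have *: "?S k * ?r * ?s \<le> ?S (Suc k)"
    by (metis \<open>C k + r + c = C (Suc k)\<close> size_union)
  have s: "0 \<le> ?s" and Sk: "0 \<le> ?S k" by (simp_all add: stay_prob_nonneg assms(1))
  have "?s ^ Suc (Suc k) = ?s ^ Suc k * ?s" by simp
  also have "\<dots> \<le> (D ^ k * ?S k) * ?s" by (intro mult_right_mono Suc s)
  also have "\<dots> \<le> (D ^ k * ?S k) * ?s * (D * ?r)"
    using mult_left_mono[OF D(2), of "(D ^ k * ?S k) * ?s"] D(1) s Sk by simp
  also have "\<dots> = D ^ Suc k * (?S k * ?r * ?s)" by simp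
  also have "\<dots> \<le> D ^ Suc k * ?S (Suc k)" using * D(1) by (intro mult_left_mono) auto
  finally show ?case .
qed

text \<open>The size of \<open>c'\<close> is left free, since return walks lengthen it and crossings
  shared by the copies shorten it. One \<open>L\<close> serves as displacement per copy, coefficient
  and exponent, which makes the property monotone in \<open>L\<close> and lets finitely many edge
  sets share a constant.\<close>

definition power_bound :: "'v::finite set set \<Rightarrow> real \<Rightarrow> 'v set set \<Rightarrow> nat \<Rightarrow> bool" where
  "power_bound E \<delta> A L \<longleftrightarrow> (\<forall>x c q. 1 \<le> q \<longrightarrow> 0 < occ_prob E \<delta> (size c) A x c \<longrightarrow>
     (\<exists>c'. (\<forall>v. count c' v \<le> q * count c v + q * L \<and> q * count c v \<le> count c' v + q * L) \<and>
       occ_prob E \<delta> (size c) A x c ^ q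
         \<le> (real L * (real (size c) + 1) ^ L) ^ q * occ_prob E \<delta> (size c') A x c'))"

lemma power_bound_mono:
  assumes "\<delta> > 0" "power_bound E \<delta> A L" "L \<le> L'"
  shows "power_bound E \<delta> A L'"
  unfolding power_bound_def
proof (intro allI impI)
  fix x and q :: nat and c :: "'a multiset" assume "1 \<le> q" "0 < occ_prob E \<delta> (size c) A x c"
  then obtain c' where c': "\<forall>v. count c' v \<le> q * count c v + q * L \<and> q * count c v \<le> count c' v + q * L"
    "occ_prob E \<delta> (size c) A x c ^ q \<le> (real L * (real (size c) + 1) ^ L) ^ q * occ_prob E \<delta> (size c') A x c'"
    using assms(2) unfolding power_bound_def by blast
  have "(real L * (real (size c) + 1) ^ L) ^ q \<le> (real L' * (real (size c) + 1) ^ L') ^ q"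
    using assms(3) by (intro power_mono mult_mono power_increasing) auto
  then have "(real L * (real (size c) + 1) ^ L) ^ q * occ_prob E \<delta> (size c') A x c'
      \<le> (real L' * (real (size c) + 1) ^ L') ^ q * occ_prob E \<delta> (size c') A x c'"
    by (intro mult_right_mono occ_prob_nonneg assms)
  moreover have "q * L \<le> q * L'" using assms(3) by simp
  ultimately show "\<exists>c'. (\<forall>v. count c' v \<le> q * count c v + q * L' \<and> q * count c v \<le> count c' v + q * L') \<and>
       occ_prob E \<delta> (size c) A x c ^ q
         \<le> (real L' * (real (size c) + 1) ^ L') ^ q * occ_prob E \<delta> (size c') A x c'"
    using c' by (intro exI[of _ c']) (auto intro: order_trans add_left_mono)
qed

text \<open>Induction on the number of vertex sets outside \<open>A\<close>. If the dominant term
  stays in \<open>A\<close>, all of \<open>c\<close> is replicated. If it exits through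
  \<open>{t, y}\<close>, only the part \<open>d\<close> before the exit is replicated, the edge is
  crossed once, and the induction hypothesis for the larger edge set replicates the
  remainder.\<close>

lemma power_bound_exists:
  fixes A E :: "'v::finite set set"
  assumes \<delta>: "\<delta> > 0"
  shows "\<exists>L. power_bound E \<delta> A L"
proof (induction "card (- A)" arbitrary: A rule: less_induct)
  case less
  obtain D :: nat where D: "D \<ge> 1" "\<And>A x t n c. stay_prob E \<delta> A n x t c > 0 \<Longrightarrow>
    \<exists>r. size r \<le> D \<and> 1 \<le> D * stay_prob E \<delta> A (size r) t x r"
    using return_walk_bound[OF \<delta>] by metis
  have "\<exists>L. \<forall>A'\<in>{A'. A \<subset> A'}. power_bound E \<delta> A' L"
  proof (rule finite_uniform_bound)
    show "\<exists>L. power_bound E \<delta> A' L" if "A' \<in> {A'. A \<subset> A'}" for A'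
    proof (rule less)
      have "- A' \<subset> - A" using that by auto
      then show "card (- A') < card (- A)" by (intro psubset_card_mono) auto
    qed
  qed (auto intro: power_bound_mono[OF \<delta>])
  then obtain L where L: "\<And>A'. A \<subset> A' \<Longrightarrow> power_bound E \<delta> A' L" by auto
  \<comment> \<open>\<open>K\<close> dominates the displacement per copy, at most
    \<open>D + L + 1\<close>, the multiplicative constant
    \<open>2 * CARD('v)^2 * D * (L + 1)\<close> and the exponent \<open>CARD('v) + L\<close>. With
    \<open>L + 1\<close> the product is large enough for the staying case even if
    \<open>L = 0\<close>.\<close>
  define K where "K = 2 * CARD('v)\<^sup>2 * D * (L + 1) + CARD('v) + D + L + 1"
  have "power_bound E \<delta> A K"
    unfolding power_bound_def
  proof (intro allI impI)
    fix x and q :: nat and c :: "'v multiset" assume q: "1 \<le> q" and pos: "0 < occ_prob E \<delta> (size c) A x c"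
    let ?W = "occ_prob E \<delta> (size c) A x c" and ?n = "size c" and ?V = "CARD('v)"
    let ?goal = "\<exists>c'. (\<forall>v. count c' v \<le> q * count c v + q * K \<and> q * count c v \<le> count c' v + q * K) \<and>
       ?W ^ q \<le> (real K * (real ?n + 1) ^ K) ^ q * occ_prob E \<delta> (size c') A x c'"
    obtain k where k: "q = Suc k" using q by (cases q) auto
    have DK: "D \<le> K" by (simp add: K_def)
    have n1: "1 \<le> (real ?n + 1) ^ i" for i by simp
    have Kbound: "real (2 * ?V\<^sup>2 * D * (L + 1)) * (real ?n + 1) ^ (?V + L) \<le> real K * (real ?n + 1) ^ K"
      by (intro mult_mono power_increasing) (auto simp: K_def)
    have V1: "?V \<ge> 1" by (simp add: Suc_leI)
    from occ_prob_large_term[OF \<delta>, where E = E and n = ?n and A = A and x = x and c = c] show ?goal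
    proof (elim disjE exE conjE)
      fix t assume "?W \<le> 2 * ?V * stay_prob E \<delta> A ?n x t c"
      then have le: "?W \<le> 2 * real ?V * stay_prob E \<delta> A ?n x t c" by simp
      have st: "stay_prob E \<delta> A ?n x t c > 0" using pos le
        by (metis not_le stay_prob_nonneg[OF \<delta>] mult_zero_right order_le_less)
      from D(2)[OF this] obtain r where r: "size r \<le> D" "1 \<le> D * stay_prob E \<delta> A (size r) t x r" by blast
      define c' where "c' = repeat_mset (Suc k) c + repeat_mset k r"
      have r': "count r v \<le> D" for v using count_le_size[of r v] r(1) by linarith
      have cnt: "count c' v \<le> q * count c v + q * K \<and> q * count c v \<le> count c' v + q * K" for v
      proof -
        have "k * count r v \<le> q * K" using r'[of v] DK k by (intro mult_mono) auto
        then show ?thesis by (simp add: c'_def k)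
      qed
      have "?W ^ q \<le> (2 * real ?V * stay_prob E \<delta> A ?n x t c) ^ q"
        using le pos by (intro power_mono) auto
      also have "\<dots> = (2 * real ?V) ^ q * stay_prob E \<delta> A ?n x t c ^ Suc k"
        by (simp only: power_mult_distrib k)
      also have "\<dots> \<le> (2 * real ?V) ^ q * (real D ^ k * stay_prob E \<delta> A (size c') x t c')"
        unfolding c'_def by (intro mult_left_mono stay_prob_power[OF \<delta> _ r(2)]) auto
      also have "\<dots> \<le> (2 * real ?V) ^ q * (real D ^ q * stay_prob E \<delta> A (size c') x t c')"
        using D(1) k by (intro mult_left_mono mult_right_mono power_increasing stay_prob_nonneg \<delta>) auto
      \<comment> \<open>With \<open>m = 0\<close> the continuation has probability 1, so this only
        forgets the end point \<open>t\<close>.\<close>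
      also have "\<dots> \<le> (2 * real ?V) ^ q * (real D ^ q * occ_prob E \<delta> (size c') A x c')"
        using stay_occ_prob_concat[OF \<delta>, where E = E and A = A and n = "size c'" and x = x and t = t and c = c' and m = 0 and d = "{#}"]
        by (intro mult_left_mono) auto
      also have "\<dots> = (2 * real ?V * real D) ^ q * occ_prob E \<delta> (size c') A x c'"
        by (simp add: power_mult_distrib)
      also have "\<dots> \<le> (real K * (real ?n + 1) ^ K) ^ q * occ_prob E \<delta> (size c') A x c'"
      proof (intro mult_right_mono occ_prob_nonneg \<delta>)
        have "?V * 1 \<le> ?V * ?V" using V1 by (intro mult_left_mono) auto
        then have "2 * ?V * D * 1 \<le> 2 * ?V\<^sup>2 * D * (L + 1)"
          by (intro mult_mono) (auto simp: power2_eq_square)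
        then have "2 * ?V * D \<le> K" by (simp add: K_def)
        then have "real (2 * ?V * D) * 1 \<le> real K * (real ?n + 1) ^ K"
          using n1 by (intro mult_mono of_nat_mono) auto
        then show "(2 * real ?V * real D) ^ q \<le> (real K * (real ?n + 1) ^ K) ^ q"
          by (intro power_mono) auto
      qed
      finally show ?goal using cnt by (intro exI[of _ c']) auto
    next
      fix d t y assume d: "size d \<le> ?n" and
        le: "?W \<le> 2 * ((?n + 1) ^ ?V * ?V ^ 2) * exit_term E \<delta> ?n A x c d t y"
      let ?P = "real (2 * ((?n + 1) ^ ?V * ?V ^ 2))"
      have "exit_term E \<delta> ?n A x c d t y > 0" using le pos exit_term_nonneg[OF \<delta>, of E ?n A x c d t y]
        by (metis mult_zero_right not_le order_le_less)
      then have ty: "{t, y} \<notin> A" and sub: "add_mset t d \<subseteq># c" and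
        ne: "stay_prob E \<delta> A (size d) x t d \<noteq> 0" "trans_prob E \<delta> A t y \<noteq> 0"
          "occ_prob E \<delta> (?n - size d - 1) (insert {t, y} A) y (c - add_mset t d) \<noteq> 0"
        by (auto simp: exit_term_def split: if_splits)
      define e where "e = c - add_mset t d"
      have c: "c = add_mset t d + e"
        unfolding e_def by (rule subset_mset.add_diff_inverse[OF sub, symmetric])
      then have ce: "?n - size d - 1 = size e" by simp
      let ?A = "insert {t, y} A"
      let ?s = "stay_prob E \<delta> A (size d) x t d" and ?p = "trans_prob E \<delta> A t y"
        and ?w = "occ_prob E \<delta> (size e) ?A y e"
      have spos: "?s > 0" "?p > 0" "?w > 0"
        using ne stay_prob_nonneg[OF \<delta>, of E A "size d" x t d] trans_prob_nonneg[OF \<delta>, of E A t y]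
          occ_prob_nonneg[OF \<delta>, of E "size e" ?A y e] unfolding ce e_def[symmetric] by auto
      have ex: "exit_term E \<delta> ?n A x c d t y = ?s * ?p * ?w"
        unfolding exit_term_def e_def[symmetric] ce using ty sub by simp
      from D(2)[OF spos(1)] obtain r where r: "size r \<le> D" "1 \<le> D * stay_prob E \<delta> A (size r) t x r" by blast
      have "power_bound E \<delta> ?A L" using ty by (intro L) auto
      then obtain e' where e': "\<forall>v. count e' v \<le> q * count e v + q * L \<and> q * count e v \<le> count e' v + q * L"
        "?w ^ q \<le> (real L * (real (size e) + 1) ^ L) ^ q * occ_prob E \<delta> (size e') ?A y e'"
        unfolding power_bound_def using q spos(3) by blast
      define C where "C = repeat_mset (Suc k) d + repeat_mset k r"
      define c' where "c' = C + add_mset t e'"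
      have r': "count r v \<le> D" for v using count_le_size[of r v] r(1) by linarith
      have cnt: "count c' v \<le> q * count c v + q * K \<and> q * count c v \<le> count c' v + q * K" for v
      proof -
        have 1: "k * count r v \<le> q * D" using r'[of v] k by (intro mult_mono) auto
        \<comment> \<open>The last \<open>q\<close> pays for the crossing point \<open>t\<close>,
          which \<open>q\<close> copies of \<open>c\<close> contain \<open>q\<close> times but
          \<open>c'\<close> only once on behalf of the crossing.\<close>
        have "q * D + q * L + q = q * (D + L + 1)" by (simp add: algebra_simps)
        also have "\<dots> \<le> q * K" by (intro mult_left_mono) (auto simp: K_def)
        finally have 2: "q * D + q * L + q \<le> q * K" .
        have c'v: "count c' v = q * count d v + k * count r v + (if v = t then 1 else 0) + count e' v"
          by (simp add: c'_def C_def k)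
        have cv: "q * count c v = q * count d v + (if v = t then q else 0) + q * count e v"
          by (simp add: c algebra_simps)
        show ?thesis using 1 2 e'(1)[rule_format, of v] q unfolding c'v cv by auto
      qed
      have "?W ^ q \<le> (?P * (?s * ?p * ?w)) ^ q"
        using le pos unfolding ex by (intro power_mono) auto
      also have "\<dots> = ?P ^ q * (?s ^ Suc k * ?p ^ q * ?w ^ q)"
        by (simp only: power_mult_distrib k)
      also have "\<dots> \<le> ?P ^ q * ((real D ^ q * stay_prob E \<delta> A (size C) x t C) * ?p *
          ((real L * (real (size e) + 1) ^ L) ^ q * occ_prob E \<delta> (size e') ?A y e'))"
      proof (intro mult_left_mono mult_mono)
        have "?s ^ Suc k \<le> real D ^ k * stay_prob E \<delta> A (size C) x t C"
          unfolding C_def by (intro stay_prob_power[OF \<delta> _ r(2)]) auto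
        also have "\<dots> \<le> real D ^ q * stay_prob E \<delta> A (size C) x t C"
          using D(1) k by (intro mult_right_mono power_increasing stay_prob_nonneg \<delta>) auto
        finally show "?s ^ Suc k \<le> real D ^ q * stay_prob E \<delta> A (size C) x t C" .
        \<comment> \<open>All copies share a single crossing of the new edge.\<close>
        show "?p ^ q \<le> ?p" using power_decreasing[of 1 q ?p] q spos trans_prob_le_1[OF \<delta>, of E A t y] by simp
      qed (use spos e'(2) \<delta> in \<open>auto intro!: mult_nonneg_nonneg stay_prob_nonneg\<close>)
      also have "\<dots> = (?P * real D * (real L * (real (size e) + 1) ^ L)) ^ q *
          (stay_prob E \<delta> A (size C) x t C * (?p * occ_prob E \<delta> (size e') ?A y e'))"
        by (simp only: power_mult_distrib mult_ac)
      also have "\<dots> \<le> (real K * (real ?n + 1) ^ K) ^ q * occ_prob E \<delta> (size c') A x c'"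
      proof (rule mult_mono[OF power_mono])
        have "real L * (real (size e) + 1) ^ L \<le> (real L + 1) * (real ?n + 1) ^ L"
          using c by (intro mult_mono power_mono) auto
        then have "?P * real D * (real L * (real (size e) + 1) ^ L) \<le> ?P * real D * ((real L + 1) * (real ?n + 1) ^ L)"
          by (intro mult_left_mono) auto
        also have "\<dots> = real (2 * ?V\<^sup>2 * D * (L + 1)) * (real ?n + 1) ^ (?V + L)"
          by (simp add: power_add algebra_simps)
        also note Kbound
        finally show "?P * real D * (real L * (real (size e) + 1) ^ L) \<le> real K * (real ?n + 1) ^ K" .
        have "?p * occ_prob E \<delta> (size e') ?A y e' \<le> occ_prob E \<delta> (Suc (size e')) A t (add_mset t e')"
          by (rule occ_prob_step[OF \<delta>])
        then have "stay_prob E \<delta> A (size C) x t C * (?p * occ_prob E \<delta> (size e') ?A y e')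
          \<le> stay_prob E \<delta> A (size C) x t C * occ_prob E \<delta> (Suc (size e')) A t (add_mset t e')"
          by (intro mult_left_mono stay_prob_nonneg \<delta>)
        also have "\<dots> \<le> occ_prob E \<delta> (size C + Suc (size e')) A x (C + add_mset t e')"
          by (rule stay_occ_prob_concat[OF \<delta>])
        finally show "stay_prob E \<delta> A (size C) x t C * (?p * occ_prob E \<delta> (size e') ?A y e')
          \<le> occ_prob E \<delta> (size c') A x c'" by (simp add: c'_def)
      qed (use spos \<delta> in \<open>auto intro!: mult_nonneg_nonneg stay_prob_nonneg occ_prob_nonneg zero_le_power\<close>)
      finally show ?goal using cnt by (intro exI[of _ c']) auto
    qed
  qed
  then show ?case by blast
qed

section \<open>Law of the occupation vector\<close>

definition traversed :: "(nat \<Rightarrow> 'v) \<Rightarrow> nat \<Rightarrow> 'v set set" where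
  "traversed x n = {{x i, x (Suc i)} | i. i < n}"

lemma orrw_step_trans_prob: "orrw_step E \<delta> x n u = trans_prob E \<delta> (traversed x n) (x n) u"
proof -
  have "orrw_weight \<delta> x n e = (if e \<in> traversed x n then \<delta> else 1)" for e
    by (auto simp: orrw_weight_def traversed_def)
  then show ?thesis by (simp add: orrw_step_def trans_prob_def)
qed

lemma traversed_cong: "(\<And>i. i \<le> n \<Longrightarrow> x i = y i) \<Longrightarrow> traversed x n = traversed y n"
  unfolding traversed_def by (metis (no_types, lifting) Suc_leI less_imp_le)

lemma traversed_Suc: "traversed x (Suc n) = insert {x n, x (Suc n)} (traversed x n)"
  unfolding traversed_def by (auto simp: less_Suc_eq)

text \<open>The window may start at any time \<open>k\<close>, so that first-step induction can move
  it. The position at time \<open>k + n\<close> is excluded, as in \<open>occ_prob\<close> and in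
  the empirical measure.\<close>

definition visits :: "(nat \<Rightarrow> 'm \<Rightarrow> 'v) \<Rightarrow> nat \<Rightarrow> nat \<Rightarrow> 'm \<Rightarrow> 'v multiset" where
  "visits X k n \<omega> = mset (map (\<lambda>i. X i \<omega>) [k..<k + n])"

lemma visits_0: "visits X k 0 \<omega> = {#}"
  by (simp add: visits_def)

lemma visits_Suc: "visits X k (Suc n) \<omega> = add_mset (X k \<omega>) (visits X (Suc k) n \<omega>)"
  unfolding visits_def by (subst upt_conv_Cons) auto

lemma size_visits: "size (visits X k n \<omega>) = n"
  by (simp add: visits_def)

lemma visits_add: "visits X k (n + m) \<omega> = visits X k n \<omega> + visits X (k + n) m \<omega>"
  unfolding visits_def by (subst add.assoc[symmetric], subst upt_add_eq_append) auto

definition cylinder :: "'m measure \<Rightarrow> (nat \<Rightarrow> 'm \<Rightarrow> 'v) \<Rightarrow> nat \<Rightarrow> (nat \<Rightarrow> 'v) \<Rightarrow> 'm set" where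
  "cylinder M X k x = {\<omega> \<in> space M. \<forall>i\<le>k. X i \<omega> = x i}"

locale orrw_process =
  fixes E :: "'v::finite set set" and \<delta> :: real and x0 :: 'v
    and M :: "'m measure" and X :: "nat \<Rightarrow> 'm \<Rightarrow> 'v"
  assumes orrw: "orrw E \<delta> x0 M X" and delta_pos: "\<delta> > 0"
begin

sublocale prob_space M
  using orrw by (simp add: orrw_def)

lemma X_measurable [measurable]: "X n \<in> measurable M (count_space UNIV)"
  using orrw by (simp add: orrw_def)

lemma history_subalgebra: "subalgebra M (history M X n)"
proof -
  have "{X i -` A \<inter> space M | i A. i \<le> n} \<subseteq> sets M"
    using measurable_sets[OF X_measurable] by auto
  then show ?thesis
    unfolding subalgebra_def history_def
    by (simp add: space_measure_of_conv sets_measure_of sets.space_closed sets.sigma_sets_subset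
        order_trans[OF _ sets.space_closed])
qed

lemma cylinder_history: "cylinder M X n x \<in> sets (history M X n)"
proof -
  let ?G = "{X i -` A \<inter> space M | i A. i \<le> n}"
  have sub: "?G \<subseteq> Pow (space M)" by auto
  have "cylinder M X n x = (\<Inter>i\<in>{..n}. X i -` {x i} \<inter> space M)"
    by (auto simp: cylinder_def)
  moreover have "(\<Inter>i\<in>{..n}. X i -` {x i} \<inter> space M) \<in> sets (sigma (space M) ?G)"
    by (intro sets.finite_INT in_measure_of sub) auto
  ultimately show ?thesis by (simp add: history_def)
qed

lemma cylinder_sets [measurable]: "cylinder M X n x \<in> sets M"
  using cylinder_history[of n x] history_subalgebra[of n] by (auto simp: subalgebra_def)

text \<open>The walk is specified only through a conditional expectation up to null sets. A cylinder
  is an event of the history on which the step probability is constant, so integrating over it gives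
  the product formula, null cylinders included.\<close>

lemma prob_cylinder_Suc:
  "prob (cylinder M X (Suc n) x)
     = trans_prob E \<delta> (traversed x n) (x n) (x (Suc n)) * prob (cylinder M X n x)"
proof -
  interpret F: finite_measure_subalgebra M "history M X n"
    by unfold_locales (rule history_subalgebra)
  let ?B = "{\<omega> \<in> space M. X (Suc n) \<omega> = x (Suc n)}" and ?C = "cylinder M X n x"
  let ?p = "trans_prob E \<delta> (traversed x n) (x n) (x (Suc n))"
  have [measurable]: "?B \<in> sets M" by measurable
  have "cylinder M X (Suc n) x = ?C \<inter> ?B"
    by (auto simp: cylinder_def le_Suc_eq)
  then have "prob (cylinder M X (Suc n) x) = (\<integral>\<omega>\<in>?C. indicator ?B \<omega> \<partial>M)"
    by (simp add: set_lebesgue_integral_def indicator_inter_arith[symmetric] Int_commute)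
  also have "\<dots> = (\<integral>\<omega>\<in>?C. real_cond_exp M (history M X n) (indicator ?B) \<omega> \<partial>M)"
    by (intro F.real_cond_exp_intA cylinder_history integrable_real_indicator) (auto simp: emeasure_eq_measure)
  also have "\<dots> = (\<integral>\<omega>\<in>?C. ?p \<partial>M)"
    unfolding set_lebesgue_integral_def
  proof (intro integral_cong_AE)
    have "AE \<omega> in M. real_cond_exp M (history M X n) (indicator ?B) \<omega>
        = orrw_step E \<delta> (\<lambda>i. X i \<omega>) n (x (Suc n))"
      using orrw by (simp add: orrw_def)
    then show "AE \<omega> in M. indicat_real ?C \<omega> *\<^sub>R real_cond_exp M (history M X n) (indicator ?B) \<omega>
        = indicat_real ?C \<omega> *\<^sub>R ?p"
    proof eventually_elim
      case (elim \<omega>)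
      show ?case
      proof (cases "\<omega> \<in> ?C")
        case True
        then have "X i \<omega> = x i" if "i \<le> n" for i using that by (simp add: cylinder_def)
        then have "traversed (\<lambda>i. X i \<omega>) n = traversed x n" "X n \<omega> = x n"
          using traversed_cong[of n "\<lambda>i. X i \<omega>" x] by blast+
        then show ?thesis using elim by (simp add: orrw_step_trans_prob)
      qed simp
    qed
  qed measurable
  also have "\<dots> = ?p * prob ?C"
    by (simp add: set_lebesgue_integral_def)
  finally show ?thesis .
qed

lemma visits_measurable [measurable]: "visits X k n \<in> measurable M (count_space UNIV)"
proof (induction n arbitrary: k)
  case 0
  then show ?case by (simp add: visits_0[abs_def])
next
  case (Suc n)
  have "(\<lambda>\<omega>. add_mset i (visits X (Suc k) n \<omega>)) \<in> measurable M (count_space UNIV)" for i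
    by (rule measurable_compose[OF Suc]) simp
  then have "(\<lambda>\<omega>. add_mset (X k \<omega>) (visits X (Suc k) n \<omega>)) \<in> measurable M (count_space UNIV)"
    by (rule measurable_compose_countable[where g = "X k"]) (rule X_measurable)
  then show ?case by (simp add: visits_Suc[abs_def])
qed

text \<open>The Markov property of (traversed edges, position). The product form avoids conditioning
  on cylinders that may be null, and the arbitrary past \<open>x\<close> makes the induction on
  \<open>n\<close> possible.\<close>

lemma prob_cylinder_visits:
  "prob (cylinder M X k x \<inter> {\<omega> \<in> space M. visits X k n \<omega> = c})
     = prob (cylinder M X k x) * occ_prob E \<delta> n (traversed x k) (x k) c"
proof (induction n arbitrary: k x c)
  case 0
  show ?case by (cases "c = {#}") (auto simp: visits_0 cylinder_def intro: arg_cong[where f = prob])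
next
  case (Suc n)
  let ?C = "cylinder M X k x" and ?V = "\<lambda>k n c. {\<omega> \<in> space M. visits X k n \<omega> = c}"
  show ?case
  proof (cases "x k \<in># c")
    case False
    then have "?C \<inter> ?V k (Suc n) c = {}" by (auto simp: cylinder_def visits_Suc)
    then show ?thesis using False by simp
  next
    case True
    let ?x = "\<lambda>y. x(Suc k := y)"
    let ?D = "\<lambda>y. cylinder M X (Suc k) (?x y) \<inter> ?V (Suc k) n (c - {#x k#})"
    have "?C \<inter> ?V k (Suc n) c = (\<Union>y. ?D y)"
      using True by (auto simp: cylinder_def visits_Suc le_Suc_eq)
    then have "prob (?C \<inter> ?V k (Suc n) c) = prob (\<Union>y. ?D y)" by simp
    also have "\<dots> = (\<Sum>y\<in>UNIV. prob (?D y))"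
      by (rule finite_measure_finite_Union) (auto simp: disjoint_family_on_def cylinder_def)
    also have "\<dots> = (\<Sum>y\<in>UNIV. trans_prob E \<delta> (traversed x k) (x k) y * prob ?C *
        occ_prob E \<delta> n (insert {x k, y} (traversed x k)) y (c - {#x k#}))"
    proof (intro sum.cong refl)
      fix y
      have "traversed (?x y) k = traversed x k" by (intro traversed_cong) auto
      moreover have "cylinder M X k (?x y) = ?C" by (auto simp: cylinder_def)
      moreover have "?x y (Suc k) = y" "?x y k = x k" by simp_all
      ultimately show "prob (?D y) = trans_prob E \<delta> (traversed x k) (x k) y * prob ?C *
        occ_prob E \<delta> n (insert {x k, y} (traversed x k)) y (c - {#x k#})"
        by (simp only: Suc prob_cylinder_Suc traversed_Suc)
    qed
    also have "\<dots> = prob ?C * occ_prob E \<delta> (Suc n) (traversed x k) (x k) c"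
      using True by (simp add: sum_distrib_left mult_ac)
    finally show ?thesis .
  qed
qed

lemma prob_visits: "prob {\<omega> \<in> space M. visits X 0 n \<omega> = c} = occ_prob E \<delta> n {} x0 c"
proof -
  let ?C = "cylinder M X 0 (\<lambda>_. x0)"
  have X0: "AE \<omega> in M. X 0 \<omega> = x0" using orrw by (simp add: orrw_def)
  then have "prob ?C = 1"
    by (intro prob_eq_1[THEN iffD2]) (auto simp: cylinder_def)
  moreover have "prob {\<omega> \<in> space M. visits X 0 n \<omega> = c} = prob (?C \<inter> {\<omega> \<in> space M. visits X 0 n \<omega> = c})"
    using X0 by (intro measure_eq_AE) (auto simp: cylinder_def)
  ultimately show ?thesis
    by (simp add: prob_cylinder_visits traversed_def)
qed

end

lemma pmf_empirical_measure:
  assumes "n > 0"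
  shows "pmf (empirical_measure X n \<omega>) v = count (visits X 0 n \<omega>) v / n"
proof -
  have ne: "{..<n} \<noteq> {}" using assms by auto
  have "pmf (empirical_measure X n \<omega>) v = card ({..<n} \<inter> (\<lambda>i. X i \<omega>) -` {v}) / n"
    by (simp add: empirical_measure_def pmf_map measure_pmf_of_set[OF ne finite_lessThan])
  also have "card ({..<n} \<inter> (\<lambda>i. X i \<omega>) -` {v}) = count (visits X 0 n \<omega>) v"
  proof (induction n)
    case (Suc n)
    have "{..<Suc n} \<inter> (\<lambda>i. X i \<omega>) -` {v} = (if X n \<omega> = v then {n} else {}) \<union> ({..<n} \<inter> (\<lambda>i. X i \<omega>) -` {v})"
      by (auto simp: less_Suc_eq)
    moreover have "visits X 0 (Suc n) \<omega> = add_mset (X n \<omega>) (visits X 0 n \<omega>)"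
      by (simp add: visits_def)
    ultimately show ?case using Suc by simp
  qed (simp add: visits_def)
  finally show ?thesis .
qed

section \<open>The weak topology on a finite space\<close>

lemma expectation_pmf_finite:
  fixes p :: "'v::finite pmf" and f :: "'v \<Rightarrow> real"
  shows "measure_pmf.expectation p f = (\<Sum>v\<in>UNIV. f v * pmf p v)"
  by (rule integral_measure_pmf_real) auto

text \<open>An expectation over a finite type is a linear function of the point masses, so subbasic
  sets contain balls in the maximum distance; conversely the indicators of single points generate
  these balls.\<close>

lemma openin_weak_topology_iff:
  fixes U :: "'v::finite pmf set"
  shows "openin weak_topology U \<longleftrightarrow>
    (\<forall>p\<in>U. \<exists>\<epsilon>>0. \<forall>q. (\<forall>v. \<bar>pmf q v - pmf p v\<bar> < \<epsilon>) \<longrightarrow> q \<in> U)"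
proof
  let ?G = "{{p :: 'v pmf. measure_pmf.expectation p f \<in> U} | (f :: 'v \<Rightarrow> real) U. bounded (range f) \<and> open U}"
  assume "openin weak_topology U"
  then have "generate_topology_on ?G U"
    unfolding weak_topology_def by (rule openin_topology_generated_by)
  then show "\<forall>p\<in>U. \<exists>\<epsilon>>0. \<forall>q. (\<forall>v. \<bar>pmf q v - pmf p v\<bar> < \<epsilon>) \<longrightarrow> q \<in> U"
  proof induction
    case (Int a b)
    show ?case
    proof
      fix p assume "p \<in> a \<inter> b"
      then obtain e1 e2 where "e1 > 0" "\<And>q. (\<forall>v. \<bar>pmf q v - pmf p v\<bar> < e1) \<Longrightarrow> q \<in> a"
        "e2 > 0" "\<And>q. (\<forall>v. \<bar>pmf q v - pmf p v\<bar> < e2) \<Longrightarrow> q \<in> b"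
        using Int by (metis IntD1 IntD2)
      then show "\<exists>\<epsilon>>0. \<forall>q. (\<forall>v. \<bar>pmf q v - pmf p v\<bar> < \<epsilon>) \<longrightarrow> q \<in> a \<inter> b"
        by (intro exI[of _ "min e1 e2"]) auto
    qed
  next
    case (UN K)
    then show ?case by (meson UnionE UnionI)
  next
    case (Basis s)
    then obtain f :: "'v \<Rightarrow> real" and S where s: "s = {p. measure_pmf.expectation p f \<in> S}" "open S"
      by blast
    show ?case
    proof
      fix p assume "p \<in> s"
      then obtain e where e: "e > 0" "\<And>y. dist y (measure_pmf.expectation p f) < e \<Longrightarrow> y \<in> S"
        using s by (auto simp: open_dist)
      let ?F = "\<Sum>v\<in>UNIV. \<bar>f v\<bar>"
      have F: "?F \<ge> 0" by (intro sum_nonneg) auto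
      have scale: "S * (e / (S + 1)) < e" if "S \<ge> 0" for S
        using that e(1) by (simp add: field_simps)
      have "q \<in> s" if q: "\<forall>v. \<bar>pmf q v - pmf p v\<bar> < e / (?F + 1)" for q
      proof -
        have "\<bar>measure_pmf.expectation q f - measure_pmf.expectation p f\<bar> = \<bar>\<Sum>v\<in>UNIV. f v * (pmf q v - pmf p v)\<bar>"
          by (simp add: expectation_pmf_finite sum_subtractf right_diff_distrib)
        also have "\<dots> \<le> (\<Sum>v\<in>UNIV. \<bar>f v\<bar> * (e / (?F + 1)))"
        proof (rule order_trans[OF sum_abs], rule sum_mono)
          fix v show "\<bar>f v * (pmf q v - pmf p v)\<bar> \<le> \<bar>f v\<bar> * (e / (?F + 1))"
            unfolding abs_mult by (rule mult_left_mono[OF less_imp_le[OF q[rule_format]]]) simp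
        qed
        also have "\<dots> = ?F * (e / (?F + 1))" by (rule sum_distrib_right[symmetric])
        also have "\<dots> < e" by (rule scale[OF F])
        finally show ?thesis using e(2) s by (simp add: dist_real_def)
      qed
      then show "\<exists>\<epsilon>>0. \<forall>q. (\<forall>v. \<bar>pmf q v - pmf p v\<bar> < \<epsilon>) \<longrightarrow> q \<in> s"
        using e(1) F by (intro exI[of _ "e / (?F + 1)"]) (auto intro!: divide_pos_pos add_nonneg_pos)
    qed
  qed auto
next
  assume *: "\<forall>p\<in>U. \<exists>\<epsilon>>0. \<forall>q. (\<forall>v. \<bar>pmf q v - pmf p v\<bar> < \<epsilon>) \<longrightarrow> q \<in> U"
  show "openin weak_topology U"
  proof (subst openin_subopen, intro ballI)
    fix p assume "p \<in> U"
    then obtain e where e: "e > 0" "\<And>q. (\<forall>v. \<bar>pmf q v - pmf p v\<bar> < e) \<Longrightarrow> q \<in> U" using * by blast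
    let ?B = "\<lambda>v. {q :: 'v pmf. measure_pmf.expectation q (indicator {v}) \<in> {pmf p v - e <..< pmf p v + e}}"
    have B: "?B v = {q. \<bar>pmf q v - pmf p v\<bar> < e}" for v
      by (auto simp: measure_pmf_single)
    have "openin weak_topology (?B v)" for v
      unfolding weak_topology_def
      by (rule topology_generated_by_Basis, unfold mem_Collect_eq,
          rule exI[of _ "indicator {v}"], rule exI[of _ "{pmf p v - e <..< pmf p v + e}"])
        (auto intro!: finite_imp_bounded)
    then have "openin weak_topology {q. \<bar>pmf q v - pmf p v\<bar> < e}" for v unfolding B .
    then have "openin weak_topology (\<Inter>v\<in>UNIV. {q. \<bar>pmf q v - pmf p v\<bar> < e})"
      by (intro openin_INT2) auto
    then show "\<exists>T. openin weak_topology T \<and> p \<in> T \<and> T \<subseteq> U"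
      by (rule_tac exI[of _ "\<Inter>v\<in>UNIV. {q. \<bar>pmf q v - pmf p v\<bar> < e}"]) (use e in auto)
  qed
qed

lemma topspace_weak_topology: "topspace (weak_topology :: 'v::finite pmf topology) = UNIV"
proof -
  have "openin weak_topology (UNIV :: 'v pmf set)"
    by (auto simp: openin_weak_topology_iff intro: exI[of _ 1])
  then show ?thesis using openin_subset by blast
qed

definition prob_simplex :: "(real ^ 'v::finite) set" where
  "prob_simplex = {x. (\<forall>v. 0 \<le> x $ v) \<and> (\<Sum>v\<in>UNIV. x $ v) = 1}"

lemma compact_prob_simplex: "compact (prob_simplex :: (real ^ 'v::finite) set)"
proof -
  have "x $ v \<le> 1" if "x \<in> prob_simplex" for x :: "real ^ 'v" and v
    using that member_le_sum[of v UNIV "($) x"] by (auto simp: prob_simplex_def)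
  then have "prob_simplex = cbox 0 (1 :: real ^ 'v) \<inter> {x. (\<Sum>v\<in>UNIV. x $ v) = 1}"
    by (auto simp: prob_simplex_def mem_box_cart)
  moreover have "closed {x :: real ^ 'v. (\<Sum>v\<in>UNIV. x $ v) = 1}"
    by (intro closed_Collect_eq continuous_intros)
  ultimately show ?thesis by (metis compact_Int_closed compact_cbox)
qed

lemma pmf_embed_simplex:
  fixes x :: "real ^ 'v::finite"
  assumes "x \<in> prob_simplex"
  shows "pmf (embed_pmf (\<lambda>v. x $ v)) v = x $ v"
proof (rule pmf_embed_pmf)
  show "(\<integral>\<^sup>+v. ennreal (x $ v) \<partial>count_space UNIV) = 1"
    using assms by (simp add: nn_integral_count_space_finite prob_simplex_def flip: ennreal_1)
qed (use assms in \<open>auto simp: prob_simplex_def\<close>)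

lemma pmf_vec_in_simplex: "(\<chi> v. pmf p v) \<in> prob_simplex"
  by (auto simp: prob_simplex_def sum_pmf_eq_1)

text \<open>Compactness is transported from the euclidean simplex, of which the space is a
  continuous image under \<open>embed_pmf\<close>.\<close>

lemma compact_space_weak_topology: "compact_space (weak_topology :: 'v::finite pmf topology)"
proof -
  let ?g = "\<lambda>x :: real ^ 'v. embed_pmf (\<lambda>v. x $ v)"
  have "continuous_map (top_of_set prob_simplex) weak_topology ?g"
    unfolding continuous_map
  proof (intro conjI allI impI)
    fix U :: "'v pmf set" assume U: "openin weak_topology U"
    show "openin (top_of_set prob_simplex) {x \<in> topspace (top_of_set prob_simplex). ?g x \<in> U}"
      unfolding openin_euclidean_subtopology_iff
    proof (intro conjI ballI)
      fix x assume x: "x \<in> {x \<in> topspace (top_of_set prob_simplex). ?g x \<in> U}"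
      then obtain e where e: "e > 0" "\<And>q. (\<forall>v. \<bar>pmf q v - pmf (?g x) v\<bar> < e) \<Longrightarrow> q \<in> U"
        using U unfolding openin_weak_topology_iff by auto
      show "\<exists>e>0. \<forall>x'\<in>prob_simplex. dist x' x < e \<longrightarrow> x' \<in> {x \<in> topspace (top_of_set prob_simplex). ?g x \<in> U}"
      proof (intro exI[of _ e] conjI ballI impI e(1))
        fix y assume y: "y \<in> prob_simplex" "dist y x < e"
        have "\<bar>y $ v - x $ v\<bar> < e" for v
          using dist_vec_nth_le[of y v x] y(2) by (simp add: dist_real_def)
        then show "y \<in> {x \<in> topspace (top_of_set prob_simplex). ?g x \<in> U}"
          using x y e(2)[of "?g y"] by (simp add: pmf_embed_simplex)
      qed
    qed auto
  qed (auto simp: topspace_weak_topology)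
  then have "compactin weak_topology (?g ` prob_simplex)"
    by (rule image_compactin[rotated]) (simp add: compactin_subtopology compact_prob_simplex)
  moreover have "p \<in> ?g ` prob_simplex" for p
  proof -
    have "p = ?g (\<chi> v. pmf p v)"
      using pmf_embed_simplex[OF pmf_vec_in_simplex[of p]] by (intro pmf_eqI) simp
    then show ?thesis using pmf_vec_in_simplex by blast
  qed
  then have "?g ` prob_simplex = UNIV" by blast
  ultimately show ?thesis by (simp add: compact_space_def topspace_weak_topology)
qed

lemma pmf_convergent_subsequence:
  fixes p :: "nat \<Rightarrow> 'v::finite pmf"
  obtains \<nu> r where "strict_mono r" "\<And>v. (\<lambda>k. pmf (p (r k)) v) \<longlonglongrightarrow> pmf \<nu> v"
proof -
  have "\<forall>k. (\<chi> v. pmf (p k) v) \<in> prob_simplex" using pmf_vec_in_simplex by blast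
  then obtain x r where x: "x \<in> prob_simplex" "strict_mono r" "((\<lambda>k. \<chi> v. pmf (p k) v) \<circ> r) \<longlonglongrightarrow> x"
    using compact_prob_simplex unfolding compact_def by metis
  have "(\<lambda>k. pmf (p (r k)) v) \<longlonglongrightarrow> pmf (embed_pmf (\<lambda>v. x $ v)) v" for v
    using tendsto_vec_nth[OF x(3), of v] by (simp add: pmf_embed_simplex[OF x(1)] o_def)
  then show ?thesis using that x(2) by blast
qed

section \<open>The rate function\<close>

text \<open>
  \<open>achievable E \<delta> x0 \<nu> h\<close>: along some sequence of times, occupation vectors close to \<open>\<nu>\<close> have
  probability at least \<open>exp (- n h)\<close>.
\<close>

definition achievable :: "'v::finite set set \<Rightarrow> real \<Rightarrow> 'v \<Rightarrow> 'v pmf \<Rightarrow> real \<Rightarrow> bool" where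
  "achievable E \<delta> x0 \<nu> h \<longleftrightarrow> (\<forall>\<epsilon>>0. \<forall>N. \<exists>c. N \<le> size c \<and>
     (\<forall>v. \<bar>count c v / size c - pmf \<nu> v\<bar> < \<epsilon>) \<and>
     exp (- (real (size c) * h)) \<le> occ_prob E \<delta> (size c) {} x0 c)"

text \<open>If nothing is achievable, the infimum of the empty set gives \<infinity>. Only
  infinitely many times are asked for, so this is the exponent of the local upper growth rate; the
  power bound is what makes it the lower one too.\<close>

definition rate :: "'v::finite set set \<Rightarrow> real \<Rightarrow> 'v \<Rightarrow> 'v pmf \<Rightarrow> ereal" where
  "rate E \<delta> x0 \<nu> = Inf (ereal ` {h. achievable E \<delta> x0 \<nu> h})"

lemma achievable_mono:
  assumes "achievable E \<delta> x0 \<nu> h" "h \<le> h'"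
  shows "achievable E \<delta> x0 \<nu> h'"
  unfolding achievable_def
proof (intro allI impI)
  fix \<epsilon> :: real and N assume "\<epsilon> > 0"
  then obtain c where c: "N \<le> size c" "\<forall>v. \<bar>count c v / size c - pmf \<nu> v\<bar> < \<epsilon>"
    "exp (- (real (size c) * h)) \<le> occ_prob E \<delta> (size c) {} x0 c"
    using assms(1) unfolding achievable_def by blast
  have "exp (- (real (size c) * h')) \<le> exp (- (real (size c) * h))"
    using mult_left_mono[OF assms(2), of "real (size c)"] by simp
  then show "\<exists>c. N \<le> size c \<and> (\<forall>v. \<bar>count c v / size c - pmf \<nu> v\<bar> < \<epsilon>) \<and>
      exp (- (real (size c) * h')) \<le> occ_prob E \<delta> (size c) {} x0 c"
    using c(1,2) order_trans[OF _ c(3)] by blast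
qed

lemma achievable_nonneg:
  assumes "\<delta> > 0" "achievable E \<delta> x0 \<nu> h"
  shows "h \<ge> 0"
proof -
  obtain c where c: "1 \<le> size c" "exp (- (real (size c) * h)) \<le> occ_prob E \<delta> (size c) {} x0 c"
    using assms(2) unfolding achievable_def by (meson zero_less_one)
  then have "exp (- (real (size c) * h)) \<le> 1"
    using occ_prob_le_1[OF assms(1), of E "size c" "{}" x0 c] by linarith
  then have "0 \<le> real (size c) * h" by simp
  then show ?thesis using c(1) by (auto simp: zero_le_mult_iff)
qed

text \<open>For fixed \<open>h\<close> the achievable measures form a closed set; this is where
  lower semicontinuity of \<open>rate\<close> comes from.\<close>

lemma achievable_closed:
  assumes "\<And>\<epsilon>. \<epsilon> > 0 \<Longrightarrow> \<exists>\<nu>'. (\<forall>v. \<bar>pmf \<nu>' v - pmf \<nu> v\<bar> < \<epsilon>) \<and> achievable E \<delta> x0 \<nu>' h"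
  shows "achievable E \<delta> x0 \<nu> h"
  unfolding achievable_def
proof (intro allI impI)
  fix \<epsilon> :: real and N assume e: "\<epsilon> > 0"
  then obtain \<nu>' where \<nu>': "\<And>v. \<bar>pmf \<nu>' v - pmf \<nu> v\<bar> < \<epsilon> / 2" "achievable E \<delta> x0 \<nu>' h"
    using assms[of "\<epsilon> / 2"] by auto
  then obtain c where c: "N \<le> size c" "\<And>v. \<bar>count c v / size c - pmf \<nu>' v\<bar> < \<epsilon> / 2"
    "exp (- (real (size c) * h)) \<le> occ_prob E \<delta> (size c) {} x0 c"
    using e unfolding achievable_def by (meson half_gt_zero)
  have "\<bar>count c v / size c - pmf \<nu> v\<bar> < \<epsilon>" for v
    using c(2)[of v] \<nu>'(1)[of v] by linarith
  then show "\<exists>c. N \<le> size c \<and> (\<forall>v. \<bar>count c v / size c - pmf \<nu> v\<bar> < \<epsilon>) \<and>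
      exp (- (real (size c) * h)) \<le> occ_prob E \<delta> (size c) {} x0 c"
    using c by blast
qed

lemma rate_le: "achievable E \<delta> x0 \<nu> h \<Longrightarrow> rate E \<delta> x0 \<nu> \<le> ereal h"
  unfolding rate_def by (rule Inf_lower) auto

lemma rate_nonneg: "\<delta> > 0 \<Longrightarrow> 0 \<le> rate E \<delta> x0 \<nu>"
  unfolding rate_def by (rule Inf_greatest) (auto dest: achievable_nonneg)

lemma rate_less_iff: "rate E \<delta> x0 \<nu> < a \<longleftrightarrow> (\<exists>h. achievable E \<delta> x0 \<nu> h \<and> ereal h < a)"
  unfolding rate_def Inf_less_iff by auto

lemma not_achievable_le_rate: "\<not> achievable E \<delta> x0 \<nu> h \<Longrightarrow> ereal h \<le> rate E \<delta> x0 \<nu>"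
  unfolding rate_def by (rule Inf_greatest) (metis achievable_mono ereal_less_eq(3) imageE linear mem_Collect_eq)

lemma size_count_sum: "size c = (\<Sum>v\<in>UNIV. count c v)" for c :: "'v::finite multiset"
  unfolding size_multiset_overloaded_eq by (rule sum.mono_neutral_left) (auto simp: count_eq_zero_iff)

text \<open>Passes from some times to all large times. One long good \<open>c\<close> is fixed and
  replicated about \<open>m / size c\<close> times; the few steps left until time \<open>m\<close>
  may be arbitrary, which is why the conclusion allows every completion \<open>d\<close>.\<close>

lemma achievable_eventually:
  fixes E :: "'v::finite set set" and h h' :: real
  assumes \<delta>: "\<delta> > 0" and ach: "achievable E \<delta> x0 \<nu> h" and h': "h < h'" and e: "\<epsilon> > 0"
  shows "eventually (\<lambda>m. \<exists>c. size c \<le> m \<and> exp (- (m * h')) \<le> occ_prob E \<delta> (size c) {} x0 c \<and>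
    (\<forall>d. size c + size d = m \<longrightarrow> (\<forall>v. \<bar>count (c + d) v / m - pmf \<nu> v\<bar> < \<epsilon>))) sequentially"
proof -
  obtain L where "power_bound E \<delta> {} L" using power_bound_exists[OF \<delta>] by blast
  \<comment> \<open>\<open>Suc L\<close> makes \<open>K\<close> at least 1, so that
    \<open>ln K\<close> is a nonnegative cost.\<close>
  then have pb: "power_bound E \<delta> {} (Suc L)" by (rule power_bound_mono[OF \<delta>]) simp
  define K where "K = Suc L"
  \<comment> \<open>In one copy each count is off by at most \<open>K\<close>, hence the size by at
    most \<open>D\<close>.\<close>
  define D where "D = CARD('v) * K"
  have "1 \<le> CARD('v)" by (simp add: Suc_leI)
  then have KD: "K \<le> D" "1 \<le> K"
    using mult_le_mono1[of 1 "CARD('v)" K] by (simp_all add: D_def K_def)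
  \<comment> \<open>The length \<open>n\<close> of the block has to be so large that the polynomial
    factor costs less than \<open>h' - h\<close> per step and that the displacement, relative to
    \<open>n\<close>, stays below a quarter of the tolerance.\<close>
  have "((\<lambda>n. (ln (real K) + real K * ln (real n + 1)) / real n) \<longlongrightarrow> 0) sequentially"
    by real_asymp
  moreover have "((\<lambda>n. 4 * real D / real n) \<longlongrightarrow> 0) sequentially" by real_asymp
  ultimately have "eventually (\<lambda>n. (ln (real K) + real K * ln (real n + 1)) / real n < h' - h \<and>
      4 * real D / real n < \<epsilon> / 4 \<and> n \<ge> 1) sequentially"
    using h' e by (intro eventually_conj order_tendstoD(2) eventually_ge_at_top) auto
  then obtain N where N: "\<And>n. n \<ge> N \<Longrightarrow> (ln (real K) + real K * ln (real n + 1)) / real n < h' - h \<and>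
      4 * real D / real n < \<epsilon> / 4 \<and> n \<ge> 1" unfolding eventually_sequentially by blast
  from ach e obtain c where c: "N \<le> size c" "\<And>v. \<bar>count c v / size c - pmf \<nu> v\<bar> < \<epsilon> / 4"
      "exp (- (real (size c) * h)) \<le> occ_prob E \<delta> (size c) {} x0 c"
    unfolding achievable_def by (meson zero_less_divide_iff zero_less_numeral)
  define n where "n = size c"
  note N' = N[OF c(1), folded n_def]
  define W where "W = occ_prob E \<delta> n {} x0 c"
  have W: "exp (- (n * h)) \<le> W" using c(3) by (simp add: W_def n_def)
  then have Wpos: "W > 0" using exp_gt_zero[of "- (n * h)"] by linarith
  \<comment> \<open>The cost of one copy: that of the block plus the logarithm of its polynomial
    factor.\<close>
  define B where "B = n * h + (ln (real K) + real K * ln (real n + 1))"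
  have "h \<ge> 0" using achievable_nonneg[OF \<delta> ach] .
  then have B: "B \<ge> 0" using KD by (auto simp: B_def intro!: add_nonneg_nonneg)
  have "ln (real K) + real K * ln (real n + 1) < (h' - h) * real n"
    using N' pos_divide_less_eq[of "real n" "ln (real K) + real K * ln (real n + 1)" "h' - h"] by simp
  then have Bn: "B \<le> n * h'" by (simp add: B_def algebra_simps)
  have step: "\<exists>c'. (\<forall>v. count c' v \<le> q * count c v + q * K \<and> q * count c v \<le> count c' v + q * K) \<and>
      exp (- (q * B)) \<le> occ_prob E \<delta> (size c') {} x0 c'" if q: "q \<ge> 1" for q :: nat
  proof -
    obtain c' where c': "\<forall>v. count c' v \<le> q * count c v + q * K \<and> q * count c v \<le> count c' v + q * K"
      "W ^ q \<le> (real K * (real n + 1) ^ K) ^ q * occ_prob E \<delta> (size c') {} x0 c'"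
      using pb Wpos q unfolding power_bound_def W_def n_def K_def by blast
    have P: "real K * (real n + 1) ^ K = exp (ln (real K) + real K * ln (real n + 1))"
      using KD by (simp add: exp_add exp_of_nat_mult)
    have "exp (- (q * (n * h))) = exp (- (n * h)) ^ q"
      by (simp add: exp_of_nat_mult[symmetric])
    also have "\<dots> \<le> W ^ q" by (intro power_mono W) simp
    also note c'(2)
    also have "(real K * (real n + 1) ^ K) ^ q = exp (q * (ln (real K) + real K * ln (real n + 1)))"
      unfolding P by (simp add: exp_of_nat_mult)
    finally have "exp (- (q * (n * h))) / exp (q * (ln (real K) + real K * ln (real n + 1)))
        \<le> occ_prob E \<delta> (size c') {} x0 c'"
      by (simp add: field_simps)
    also have "exp (- (q * (n * h))) / exp (q * (ln (real K) + real K * ln (real n + 1))) = exp (- (q * B))"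
      by (simp add: B_def exp_diff[symmetric] algebra_simps)
    finally show ?thesis using c'(1) by blast
  qed
  have "((\<lambda>m. 2 * (real n + real D) / real m) \<longlongrightarrow> 0) sequentially" by real_asymp
  then have "eventually (\<lambda>m. 2 * (real n + real D) / real m < \<epsilon> / 4 \<and> m \<ge> n + D) sequentially"
    using e by (intro eventually_conj order_tendstoD(2) eventually_ge_at_top) auto
  then show ?thesis
  proof eventually_elim
    case (elim m)
    \<comment> \<open>Dividing by \<open>n + D\<close> instead of \<open>n\<close> guarantees that
      the displaced multiset \<open>c'\<close> still fits into time \<open>m\<close>.\<close>
    define q where "q = m div (n + D)"
    have nD: "n + D > 0" using N' by simp
    have q1: "q \<ge> 1" using elim nD by (simp add: q_def Suc_le_eq div_greater_zero_iff)
    have qle: "q * (n + D) \<le> m" by (simp add: q_def)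
    have qge: "m \<le> q * (n + D) + (n + D)"
      using div_mult_mod_eq[of m "n + D"] mod_less_divisor[OF nD, of m] unfolding q_def by linarith
    obtain c' where c': "\<And>v. count c' v \<le> q * count c v + q * K" "\<And>v. q * count c v \<le> count c' v + q * K"
      "exp (- (q * B)) \<le> occ_prob E \<delta> (size c') {} x0 c'" using step[OF q1] by blast
    have "size c' \<le> (\<Sum>v\<in>UNIV. q * count c v + q * K)"
      unfolding size_count_sum[of c'] by (intro sum_mono c')
    also have "\<dots> = q * (n + D)"
      by (simp add: sum.distrib sum_distrib_left[symmetric] n_def size_count_sum[of c] D_def algebra_simps)
    finally have sle: "size c' \<le> q * (n + D)" .
    have "q * n = (\<Sum>v\<in>UNIV. q * count c v)" by (simp add: n_def size_count_sum sum_distrib_left)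
    also have "\<dots> \<le> (\<Sum>v\<in>UNIV. count c' v + q * K)" by (intro sum_mono c')
    also have "\<dots> = size c' + q * D" by (simp add: sum.distrib size_count_sum[of c'] D_def)
    finally have sge: "q * n \<le> size c' + q * D" .
    have "q * B \<le> m * h'"
    proof -
      have "q * B \<le> q * (n * h')" using Bn by (intro mult_left_mono) auto
      also have "\<dots> = (q * n) * h'" by simp
      also have "\<dots> \<le> m * h'"
        using \<open>h \<ge> 0\<close> h' qle by (intro mult_right_mono) (auto simp: algebra_simps of_nat_mult[symmetric] simp del: of_nat_mult)
      finally show ?thesis .
    qed
    then have ex: "exp (- (m * h')) \<le> occ_prob E \<delta> (size c') {} x0 c'"
      using c'(3) by (meson exp_le_cancel_iff neg_le_iff_le order_trans)
    have near: "\<bar>count (c' + d) v / m - pmf \<nu> v\<bar> < \<epsilon>" if d: "size c' + size d = m" for d v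
    proof -
      define f where "f = count c v / n"
      have n0: "real n > 0" "real m > 0" using N' elim by auto
      have f: "0 \<le> f" "f \<le> 1" "n * f = count c v"
        using n0 count_le_size[of c v] by (auto simp: f_def n_def)
      have cf: "q * count c v = q * n * f" using f(3) by simp
      have a1: "real (count c' v) \<le> q * n * f + q * D"
      proof -
        have "real (count c' v) \<le> real (q * count c v + q * K)" using c'(1) of_nat_le_iff by blast
        also have "\<dots> = q * n * f + q * K" using cf by simp
        also have "\<dots> \<le> q * n * f + q * D" using KD by (auto intro!: mult_left_mono)
        finally show ?thesis .
      qed
      have a2: "q * n * f \<le> real (count c' v) + q * D"
      proof -
        have "q * n * f = real (q * count c v)" unfolding cf[symmetric] by simp
        also have "\<dots> \<le> real (count c' v + q * K)" using c'(2) of_nat_le_iff by blast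
        also have "\<dots> \<le> real (count c' v) + q * D" using KD by (auto intro!: mult_left_mono)
        finally show ?thesis .
      qed
      have a3: "real (count d v) \<le> 2 * (q * D) + (n + D)"
      proof -
        have "size d \<le> 2 * (q * D) + (n + D)" using d qge sge by (simp add: algebra_simps)
        then have "count d v \<le> 2 * (q * D) + (n + D)" using count_le_size[of d v] by linarith
        then show ?thesis by (metis of_nat_le_iff)
      qed
      have a4: "m * f - q * n * f \<ge> 0" "m * f - q * n * f \<le> q * D + (n + D)"
      proof -
        have 1: "0 \<le> real m - q * n" using qle by (simp add: algebra_simps of_nat_mult[symmetric] of_nat_add[symmetric] del: of_nat_mult of_nat_add)
        have "real m \<le> real (q * (n + D) + (n + D))" using qge of_nat_le_iff by blast
        then have 2: "real m - q * n \<le> q * D + (n + D)" by (simp add: algebra_simps)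
        have "m * f - q * n * f = (real m - q * n) * f" by (simp add: algebra_simps)
        moreover have "(real m - q * n) * f \<le> (real m - q * n) * 1" using 1 f by (intro mult_left_mono) auto
        ultimately show "m * f - q * n * f \<ge> 0" "m * f - q * n * f \<le> q * D + (n + D)"
          using 1 2 f by auto
      qed
      \<comment> \<open>The right side adds up three errors: \<open>q * D\<close> between
        \<open>c'\<close> and the copies, \<open>2 * (q * D) + (n + D)\<close> for the completion
        \<open>d\<close>, and \<open>q * D + (n + D)\<close> for the missing length
        \<open>m - q * n\<close>.\<close>
      have "\<bar>real (count (c' + d) v) - m * f\<bar> \<le> 4 * (q * D) + 2 * (n + D)"
        using a1 a2 a3 a4 by (simp add: abs_le_iff)
      then have "\<bar>real (count (c' + d) v) - m * f\<bar> / m \<le> real (4 * (q * D) + 2 * (n + D)) / m"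
        by (rule divide_right_mono) simp
      moreover have "\<bar>real (count (c' + d) v) - m * f\<bar> / m = \<bar>(real (count (c' + d) v) - m * f) / m\<bar>"
        by simp
      moreover have "(real (count (c' + d) v) - m * f) / m = count (c' + d) v / m - f"
        using n0(2) by (simp add: diff_divide_distrib)
      ultimately have "\<bar>count (c' + d) v / m - f\<bar> \<le> real (4 * (q * D) + 2 * (n + D)) / m"
        by (simp only:)
      also have "\<dots> = 4 * (q * D) / m + 2 * (real n + D) / m"
        by (simp add: add_divide_distrib)
      also have "4 * (q * D) / m \<le> 4 * real D / n"
      proof -
        have "q * n \<le> m" using qle by (simp add: add_mult_distrib2)
        then have "real q * n \<le> m" by (metis of_nat_le_iff of_nat_mult)
        then have "real q * n * (4 * real D) \<le> m * (4 * real D)" by (intro mult_right_mono) auto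
        then show ?thesis using n0 by (simp add: field_simps)
      qed
      also have "4 * real D / n + 2 * (real n + D) / m < \<epsilon> / 4 + \<epsilon> / 4"
        using N' elim by (intro add_strict_mono) blast+
      finally have "\<bar>count (c' + d) v / m - f\<bar> < \<epsilon> / 4 + \<epsilon> / 4" by simp
      moreover have "\<bar>f - pmf \<nu> v\<bar> < \<epsilon> / 4" using c(2)[of v] by (simp add: f_def n_def)
      ultimately show ?thesis using e by linarith
    qed
    have "size c' \<le> m" using sle qle by simp
    then show ?case using ex near by blast
  qed
qed

section \<open>The large deviation principle\<close>

text \<open>The whole space is compact, so compact level sets follow from their closedness, that is
  from lower semicontinuity.\<close>

lemma rate_good:
  fixes E :: "'v::finite set set"
  assumes \<delta>: "\<delta> > 0" and fin: "\<exists>\<nu>. rate E \<delta> x0 \<nu> < \<infinity>"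
  shows "good_rate_function weak_topology (rate E \<delta> x0)"
proof -
  have lsc: "openin weak_topology {\<nu>. a < rate E \<delta> x0 \<nu>}" for a
    unfolding openin_weak_topology_iff
  proof
    fix \<nu> assume "\<nu> \<in> {\<nu>. a < rate E \<delta> x0 \<nu>}"
    then obtain h where h: "a < ereal h" "ereal h < rate E \<delta> x0 \<nu>" using ereal_dense2 by blast
    then have "\<not> achievable E \<delta> x0 \<nu> h" using rate_le by (metis leD)
    then obtain \<epsilon> where e: "\<epsilon> > 0" "\<And>\<nu>'. (\<forall>v. \<bar>pmf \<nu>' v - pmf \<nu> v\<bar> < \<epsilon>) \<Longrightarrow> \<not> achievable E \<delta> x0 \<nu>' h"
      using achievable_closed by metis
    then have "a < rate E \<delta> x0 \<nu>'" if "\<forall>v. \<bar>pmf \<nu>' v - pmf \<nu> v\<bar> < \<epsilon>" for \<nu>'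
      using not_achievable_le_rate[OF e(2)[OF that]] h(1) by simp
    then show "\<exists>\<epsilon>>0. \<forall>q. (\<forall>v. \<bar>pmf q v - pmf \<nu> v\<bar> < \<epsilon>) \<longrightarrow> q \<in> {\<nu>. a < rate E \<delta> x0 \<nu>}"
      using e(1) by blast
  qed
  have "compactin weak_topology {\<nu>. rate E \<delta> x0 \<nu> \<le> ereal a}" for a
  proof (rule closedin_compact_space[OF compact_space_weak_topology])
    have "{\<nu>. rate E \<delta> x0 \<nu> \<le> ereal a} = UNIV - {\<nu>. ereal a < rate E \<delta> x0 \<nu>}" by auto
    then show "closedin weak_topology {\<nu>. rate E \<delta> x0 \<nu> \<le> ereal a}"
      using lsc[of "ereal a"] by (simp add: openin_closedin_eq topspace_weak_topology)
  qed
  then show ?thesis using lsc fin \<delta>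
    by (simp add: good_rate_function_def lower_semicontinuous_def topspace_weak_topology rate_nonneg)
qed

context orrw_process
begin

lemma empirical_measure_visits:
  assumes "n \<ge> 1" "visits X 0 n \<omega> = visits X 0 n \<omega>'"
  shows "empirical_measure X n \<omega> = empirical_measure X n \<omega>'"
  using assms by (intro pmf_eqI) (simp add: pmf_empirical_measure)

text \<open>The empirical measure factors through \<open>visits\<close>, which takes finitely many
  values at time \<open>n\<close>. So the event is a finite union of fibres for every set
  \<open>S\<close>, measurable or not.\<close>

lemma empirical_event:
  assumes "n \<ge> 1"
  shows "{\<omega> \<in> space M. empirical_measure X n \<omega> \<in> S}
    = (\<Union>c\<in>{c. size c = n \<and> (\<exists>\<omega>\<in>space M. visits X 0 n \<omega> = c \<and> empirical_measure X n \<omega> \<in> S)}.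
        {\<omega> \<in> space M. visits X 0 n \<omega> = c})"
    (is "?L = ?R")
proof (rule set_eqI, rule iffI)
  fix \<omega> assume "\<omega> \<in> ?L"
  then show "\<omega> \<in> ?R" using size_visits[of X 0 n \<omega>] by blast
next
  fix \<omega> assume "\<omega> \<in> ?R"
  then obtain \<omega>' where "\<omega> \<in> space M" "visits X 0 n \<omega>' = visits X 0 n \<omega>" "empirical_measure X n \<omega>' \<in> S"
    by auto
  then show "\<omega> \<in> ?L" using empirical_measure_visits[OF assms, of \<omega>' \<omega>] by simp
qed

lemma finite_multisets_size_eq: "finite {c :: 'v multiset. size c = n \<and> P c}"
  by (rule finite_subset[OF _ finite_multisets_size_le[of n]]) auto

lemma empirical_event_sets:
  assumes "n \<ge> 1"
  shows "{\<omega> \<in> space M. empirical_measure X n \<omega> \<in> S} \<in> sets M"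
  unfolding empirical_event[OF assms] by (intro sets.finite_UN finite_multisets_size_eq) measurable

lemma empirical_measure_measurable:
  assumes "n \<ge> 1"
  shows "empirical_measure X n \<in> measurable M (sigma (topspace weak_topology) {U. openin weak_topology U})"
proof (rule measurable_sigma_sets)
  show "sets (sigma (topspace weak_topology) {U. openin weak_topology U})
      = sigma_sets (topspace weak_topology) {U. openin weak_topology (U :: 'v pmf set)}"
    by (rule sets_measure_of) (simp add: topspace_weak_topology)
next
  fix U :: "'v pmf set"
  have "empirical_measure X n -` U \<inter> space M = {\<omega> \<in> space M. empirical_measure X n \<omega> \<in> U}" by auto
  then show "empirical_measure X n -` U \<inter> space M \<in> sets M"
    using empirical_event_sets[OF assms] by simp
qed (auto simp: topspace_weak_topology)

text \<open>Prescribing only the first \<open>size c\<close> visits forces the empirical measure at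
  time \<open>m\<close> into \<open>U\<close>, whatever the walk does afterwards.\<close>

lemma empirical_prob_lower:
  assumes U: "openin weak_topology U" "\<nu> \<in> U" and ach: "achievable E \<delta> x0 \<nu> h" "h < h'"
  shows "eventually (\<lambda>m. exp (- (real m * h')) \<le> prob {\<omega> \<in> space M. empirical_measure X m \<omega> \<in> U}) sequentially"
proof -
  obtain \<epsilon> where e: "\<epsilon> > 0" "\<And>q. (\<forall>v. \<bar>pmf q v - pmf \<nu> v\<bar> < \<epsilon>) \<Longrightarrow> q \<in> U"
    using U unfolding openin_weak_topology_iff by blast
  from achievable_eventually[OF delta_pos ach e(1)] eventually_ge_at_top[of 1]
  show ?thesis
  proof eventually_elim
    case (elim m)
    then obtain c where c: "size c \<le> m" "exp (- (real m * h')) \<le> occ_prob E \<delta> (size c) {} x0 c"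
      "\<And>d v. size c + size d = m \<Longrightarrow> \<bar>count (c + d) v / m - pmf \<nu> v\<bar> < \<epsilon>" by blast
    have "empirical_measure X m \<omega> \<in> U" if "visits X 0 (size c) \<omega> = c" for \<omega>
    proof (intro e(2) allI)
      fix v
      have "visits X 0 m \<omega> = c + visits X (size c) (m - size c) \<omega>"
        using visits_add[of X 0 "size c" "m - size c" \<omega>] c(1) that by simp
      then show "\<bar>pmf (empirical_measure X m \<omega>) v - pmf \<nu> v\<bar> < \<epsilon>"
        using c(3)[of "visits X (size c) (m - size c) \<omega>" v] c(1) elim(2)
        by (simp add: pmf_empirical_measure size_visits)
    qed
    then have "prob {\<omega> \<in> space M. visits X 0 (size c) \<omega> = c} \<le> prob {\<omega> \<in> space M. empirical_measure X m \<omega> \<in> U}"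
      using elim(2) by (intro finite_measure_mono empirical_event_sets) auto
    then show ?case using c(2) by (simp add: prob_visits)
  qed
qed

text \<open>If multisets violating the bound occurred at arbitrarily large times, their frequencies
  would have a limit point; it lies in the closed set \<open>C\<close> and is achievable with
  \<open>h\<close>, a contradiction. A union bound over polynomially many multisets then
  suffices.\<close>

lemma empirical_prob_upper:
  assumes C: "closedin weak_topology C" and h: "\<And>\<nu>. \<nu> \<in> C \<Longrightarrow> \<not> achievable E \<delta> x0 \<nu> h"
  shows "eventually (\<lambda>n. prob {\<omega> \<in> space M. empirical_measure X n \<omega> \<in> C}
    \<le> (real n + 1) ^ CARD('v) * exp (- (real n * h))) sequentially"
proof -
  define S where "S = (\<lambda>n. {c. size c = n \<and> (\<exists>\<omega>\<in>space M. visits X 0 n \<omega> = c \<and> empirical_measure X n \<omega> \<in> C)})"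
  have "eventually (\<lambda>n. \<forall>c\<in>S n. occ_prob E \<delta> n {} x0 c \<le> exp (- (real n * h))) sequentially"
  proof (rule ccontr)
    assume "\<not> ?thesis"
    then have "\<forall>N. \<exists>n\<ge>N. \<exists>c\<in>S n. exp (- (real n * h)) < occ_prob E \<delta> n {} x0 c"
      unfolding eventually_sequentially by (meson not_le)
    \<comment> \<open>\<open>Suc k\<close> makes the times both unbounded and positive; at time 0
      the frequencies would be meaningless.\<close>
    then have "\<forall>k. \<exists>n. Suc k \<le> n \<and> (\<exists>c\<in>S n. exp (- (real n * h)) < occ_prob E \<delta> n {} x0 c)" by blast
    then obtain f c where f: "\<And>k. Suc k \<le> f k" "\<And>k. c k \<in> S (f k)"
      "\<And>k. exp (- (real (f k) * h)) < occ_prob E \<delta> (f k) {} x0 (c k)" by metis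
    then have "\<forall>k. \<exists>\<omega>\<in>space M. visits X 0 (f k) \<omega> = c k \<and> empirical_measure X (f k) \<omega> \<in> C"
      by (auto simp: S_def)
    then obtain w where w: "\<And>k. visits X 0 (f k) (w k) = c k" "\<And>k. empirical_measure X (f k) (w k) \<in> C"
      by metis
    define p where "p = (\<lambda>k. empirical_measure X (f k) (w k))"
    have p: "pmf (p k) v = count (c k) v / size (c k)" and sz: "size (c k) = f k" for k v
      using f(1)[of k] w(1)[of k] size_visits[of X 0 "f k" "w k"]
      by (auto simp: p_def pmf_empirical_measure)
    obtain \<nu> r where r: "strict_mono r" "\<And>v. (\<lambda>k. pmf (p (r k)) v) \<longlonglongrightarrow> pmf \<nu> v"
      using pmf_convergent_subsequence[of p] by blast
    have near: "eventually (\<lambda>k. \<forall>v\<in>UNIV. \<bar>pmf (p (r k)) v - pmf \<nu> v\<bar> < \<epsilon>) sequentially" if "\<epsilon> > 0" for \<epsilon>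
    proof (rule eventually_ball_finite[OF finite], intro ballI)
      fix v show "eventually (\<lambda>k. \<bar>pmf (p (r k)) v - pmf \<nu> v\<bar> < \<epsilon>) sequentially"
        using tendstoD[OF r(2) that, of v] by (simp add: dist_real_def)
    qed
    have "\<nu> \<in> C"
    proof (rule ccontr)
      assume "\<nu> \<notin> C"
      moreover have "openin weak_topology (- C)" using C
        by (simp add: closedin_def topspace_weak_topology Compl_eq_Diff_UNIV)
      ultimately obtain \<epsilon> where "\<epsilon> > 0" "\<And>q. (\<forall>v. \<bar>pmf q v - pmf \<nu> v\<bar> < \<epsilon>) \<Longrightarrow> q \<in> - C"
        unfolding openin_weak_topology_iff by blast
      moreover obtain k where "\<forall>v. \<bar>pmf (p (r k)) v - pmf \<nu> v\<bar> < \<epsilon>"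
        using near[OF \<open>\<epsilon> > 0\<close>] by (auto dest: eventually_happens)
      ultimately show False using w(2)[of "r k"] by (auto simp: p_def)
    qed
    moreover have "achievable E \<delta> x0 \<nu> h"
      unfolding achievable_def
    proof (intro allI impI)
      fix \<epsilon> :: real and N assume "\<epsilon> > 0"
      from eventually_conj[OF near[OF this] eventually_ge_at_top[of N]]
      obtain k where k: "\<forall>v. \<bar>pmf (p (r k)) v - pmf \<nu> v\<bar> < \<epsilon>" "N \<le> k"
        by (auto dest: eventually_happens)
      have "N \<le> size (c (r k))" using k(2) seq_suble[OF r(1), of k] f(1)[of "r k"] by (simp add: sz)
      then show "\<exists>c. N \<le> size c \<and> (\<forall>v. \<bar>count c v / size c - pmf \<nu> v\<bar> < \<epsilon>) \<and>
          exp (- (real (size c) * h)) \<le> occ_prob E \<delta> (size c) {} x0 c"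
        using k(1) f(3)[of "r k"] by (intro exI[of _ "c (r k)"]) (auto simp: p sz)
    qed
    ultimately show False using h by blast
  qed
  then show ?thesis using eventually_ge_at_top[of 1]
  proof eventually_elim
    case (elim n)
    have ev: "{\<omega> \<in> space M. empirical_measure X n \<omega> \<in> C} = (\<Union>c\<in>S n. {\<omega> \<in> space M. visits X 0 n \<omega> = c})"
      using empirical_event[OF elim(2), of C] by (simp add: S_def)
    have S: "finite (S n)" unfolding S_def by (rule finite_multisets_size_eq)
    have "prob {\<omega> \<in> space M. empirical_measure X n \<omega> \<in> C} \<le> (\<Sum>c\<in>S n. prob {\<omega> \<in> space M. visits X 0 n \<omega> = c})"
      unfolding ev by (intro finite_measure_subadditive_finite S) auto
    also have "\<dots> \<le> of_nat (card (S n)) * exp (- (real n * h))"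
      using elim(1) by (intro sum_bounded_above) (simp add: prob_visits)
    also have "\<dots> \<le> (real n + 1) ^ CARD('v) * exp (- (real n * h))"
    proof (intro mult_right_mono)
      have "card (S n) \<le> card {c :: 'v multiset. size c \<le> n}"
        by (intro card_mono finite_multisets_size_le) (auto simp: S_def)
      also have "\<dots> \<le> (n + 1) ^ CARD('v)" by (rule card_multisets_size_le)
      finally have "real (card (S n)) \<le> real ((n + 1) ^ CARD('v))" by (rule of_nat_mono)
      then show "real (card (S n)) \<le> (real n + 1) ^ CARD('v)" by (simp add: add.commute)
    qed simp
    finally show ?case .
  qed
qed

lemma satisfies_LDP_rate: "satisfies_LDP weak_topology M (empirical_measure X) (rate E \<delta> x0)"
  unfolding satisfies_LDP_def
proof (intro conjI allI impI)
  fix C :: "'v pmf set" assume C: "closedin weak_topology C"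
  let ?P = "\<lambda>n. {\<omega> \<in> space M. empirical_measure X n \<omega> \<in> C}"
  \<comment> \<open>Working with every real \<open>h\<close> below the infimum also covers an
    infinite infimum, in particular the empty set \<open>C\<close>.\<close>
  have bound: "limsup (\<lambda>n. scaled_log_prob M n (?P n)) \<le> ereal (- h)"
    if h: "ereal h < (INF \<nu>\<in>C. rate E \<delta> x0 \<nu>)" for h
  proof -
    have "\<not> achievable E \<delta> x0 \<nu> h" if "\<nu> \<in> C" for \<nu>
      using h INF_lower[OF that, of "rate E \<delta> x0"] rate_le[of E \<delta> x0 \<nu> h] by fastforce
    then have "eventually (\<lambda>n. prob (?P n) \<le> (real n + 1) ^ CARD('v) * exp (- (real n * h))) sequentially"
      by (rule empirical_prob_upper[OF C])
    from this eventually_ge_at_top[of 1]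
    have "eventually (\<lambda>n. scaled_log_prob M n (?P n) \<le> ereal (CARD('v) * ln (real n + 1) / n - h)) sequentially"
    proof eventually_elim
      case (elim n)
      show ?case
      proof (cases "prob (?P n) = 0")
        case False
        then have pos: "prob (?P n) > 0" using measure_nonneg[of M] by (simp add: less_le)
        have "ln (prob (?P n)) \<le> ln ((real n + 1) ^ CARD('v) * exp (- (real n * h)))"
          using elim(1) pos by simp
        also have "\<dots> = CARD('v) * ln (real n + 1) - n * h"
          by (simp add: ln_mult ln_realpow)
        finally have "ln (prob (?P n)) / n \<le> (CARD('v) * ln (real n + 1) - n * h) / n"
          by (rule divide_right_mono) simp
        also have "\<dots> = CARD('v) * ln (real n + 1) / n - h" using elim(2) by (simp add: field_simps)
        finally show ?thesis using False by (simp add: scaled_log_prob_def)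
      qed (simp add: scaled_log_prob_def)
    qed
    then have "limsup (\<lambda>n. scaled_log_prob M n (?P n)) \<le> limsup (\<lambda>n. ereal (CARD('v) * ln (real n + 1) / n - h))"
      by (rule Limsup_mono)
    also have "(\<lambda>n. ln (real n + 1) / real n) \<longlonglongrightarrow> 0"
      by real_asymp
    then have "(\<lambda>n. CARD('v) * (ln (real n + 1) / real n) - h) \<longlonglongrightarrow> real CARD('v) * 0 - h"
      by (intro tendsto_intros)
    then have "(\<lambda>n. CARD('v) * ln (real n + 1) / n - h) \<longlonglongrightarrow> - h" by simp
    then have "limsup (\<lambda>n. ereal (CARD('v) * ln (real n + 1) / n - h)) = ereal (- h)"
      by (intro lim_imp_Limsup) (auto intro: tendsto_ereal)
    finally show ?thesis .
  qed
  show "limsup (\<lambda>n. scaled_log_prob M n (?P n)) \<le> - (INF \<nu>\<in>C. rate E \<delta> x0 \<nu>)"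
  proof (rule ccontr)
    assume "\<not> ?thesis"
    then have "- (INF \<nu>\<in>C. rate E \<delta> x0 \<nu>) < limsup (\<lambda>n. scaled_log_prob M n (?P n))"
      by (simp only: not_le)
    from ereal_dense2[OF this] obtain r where
      r: "- (INF \<nu>\<in>C. rate E \<delta> x0 \<nu>) < ereal r" "ereal r < limsup (\<lambda>n. scaled_log_prob M n (?P n))"
      by blast
    have "- ereal r < (INF \<nu>\<in>C. rate E \<delta> x0 \<nu>)"
      using r(1) by (rule ereal_uminus_less_reorder[THEN iffD1])
    then show False using bound[of "- r"] r(2) by simp
  qed
next
  fix U :: "'v pmf set" assume U: "openin weak_topology U"
  let ?P = "\<lambda>n. {\<omega> \<in> space M. empirical_measure X n \<omega> \<in> U}"
  show "- (INF \<nu>\<in>U. rate E \<delta> x0 \<nu>) \<le> liminf (\<lambda>n. scaled_log_prob M n (?P n))"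
  proof (rule ccontr)
    assume "\<not> ?thesis"
    then have "liminf (\<lambda>n. scaled_log_prob M n (?P n)) < - (INF \<nu>\<in>U. rate E \<delta> x0 \<nu>)"
      by (simp only: not_le)
    then have "(INF \<nu>\<in>U. rate E \<delta> x0 \<nu>) < - liminf (\<lambda>n. scaled_log_prob M n (?P n))"
      by (rule ereal_less_uminus_reorder[THEN iffD1])
    then obtain \<nu> h where \<nu>: "\<nu> \<in> U" "achievable E \<delta> x0 \<nu> h" "ereal h < - liminf (\<lambda>n. scaled_log_prob M n (?P n))"
      unfolding INF_less_iff rate_less_iff by blast
    from ereal_dense2[OF \<nu>(3)] obtain h' where h': "h < h'" "ereal h' < - liminf (\<lambda>n. scaled_log_prob M n (?P n))"
      by auto
    from empirical_prob_lower[OF U \<nu>(1,2) h'(1)] eventually_ge_at_top[of 1]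
    have "eventually (\<lambda>n. ereal (- h') \<le> scaled_log_prob M n (?P n)) sequentially"
    proof eventually_elim
      case (elim n)
      then have pos: "prob (?P n) > 0" by (meson exp_gt_zero less_le_trans)
      have "- (n * h') \<le> ln (prob (?P n))" using elim(1) pos by (simp add: ln_ge_iff)
      then have "- h' \<le> ln (prob (?P n)) / n" using elim(2) by (simp add: field_simps)
      then show ?case using pos by (simp add: scaled_log_prob_def)
    qed
    then have "ereal (- h') \<le> liminf (\<lambda>n. scaled_log_prob M n (?P n))"
      by (rule Liminf_bounded)
    then have "- liminf (\<lambda>n. scaled_log_prob M n (?P n)) \<le> ereal h'"
      by (simp add: ereal_uminus_le_reorder)
    then show False using h'(2) by simp
  qed
qed (rule empirical_measure_measurable)

end

section \<open>Dependence on the reinforcement\<close>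

text \<open>The denominator grows with \<delta>, but at most proportionally. So an old edge, whose
  weight is proportional to \<delta>, gains from a larger \<delta>, by at most the ratio, while a
  new edge loses at most the ratio.\<close>

lemma trans_prob_le_new_edge_factor:
  fixes E :: "'v::finite set set"
  assumes "0 < \<delta>1" "\<delta>1 \<le> \<delta>2"
  shows "trans_prob E \<delta>1 A x y \<le> (if {x, y} \<in> A then 1 else \<delta>2 / \<delta>1) * trans_prob E \<delta>2 A x y"
    and "trans_prob E \<delta>2 A x y \<le> \<delta>2 / \<delta>1 * trans_prob E \<delta>1 A x y"
proof -
  let ?D = "\<lambda>\<delta>. \<Sum>u | adjacent E x u. if {x, u} \<in> A then \<delta> else (1::real)"
  show "trans_prob E \<delta>1 A x y \<le> (if {x, y} \<in> A then 1 else \<delta>2 / \<delta>1) * trans_prob E \<delta>2 A x y"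
    "trans_prob E \<delta>2 A x y \<le> \<delta>2 / \<delta>1 * trans_prob E \<delta>1 A x y"
  proof (atomize (full), cases "adjacent E x y")
    case True
    have pos: "?D \<delta>1 > 0" "?D \<delta>2 > 0"
      using trans_denom_pos[OF _ True, of \<delta>1 A] trans_denom_pos[OF _ True, of \<delta>2 A] assms by auto
    have t: "trans_prob E \<delta> A x y = (if {x, y} \<in> A then \<delta> else 1) / ?D \<delta>" for \<delta>
      using True by (simp add: trans_prob_def)
    have "\<delta>1 * ?D \<delta>2 \<le> \<delta>2 * ?D \<delta>1"
      unfolding sum_distrib_left using assms by (intro sum_mono) auto
    then have a: "1 / ?D \<delta>1 \<le> \<delta>2 / \<delta>1 * (1 / ?D \<delta>2)" "\<delta>1 / ?D \<delta>1 \<le> \<delta>2 / ?D \<delta>2"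
      using pos assms by (simp_all add: field_simps)
    have "?D \<delta>1 \<le> ?D \<delta>2" using assms by (intro sum_mono) auto
    then have b: "1 / ?D \<delta>2 \<le> 1 / ?D \<delta>1" using pos by (intro divide_left_mono) auto
    then have c: "\<delta>2 / ?D \<delta>2 \<le> \<delta>2 / \<delta>1 * (\<delta>1 / ?D \<delta>1)"
      using mult_left_mono[OF b, of \<delta>2] assms by simp
    have "1 * (1 / ?D \<delta>1) \<le> \<delta>2 / \<delta>1 * (1 / ?D \<delta>1)"
      using assms pos by (intro mult_right_mono) auto
    then have d: "1 / ?D \<delta>2 \<le> \<delta>2 / \<delta>1 * (1 / ?D \<delta>1)" using b by linarith
    show "trans_prob E \<delta>1 A x y \<le> (if {x, y} \<in> A then 1 else \<delta>2 / \<delta>1) * trans_prob E \<delta>2 A x y \<and>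
      trans_prob E \<delta>2 A x y \<le> \<delta>2 / \<delta>1 * trans_prob E \<delta>1 A x y"
      unfolding t using a c d by (cases "{x, y} \<in> A") (simp_all only: if_True if_False mult_1_left simp_thms)
  qed (simp add: trans_prob_eq_0)
qed

text \<open>A factor is lost only when a new edge is traversed. The total loss is independent of
  \<open>n\<close> and therefore invisible in the rate.\<close>

lemma occ_prob_mono_reinforcement:
  fixes E :: "'v::finite set set"
  assumes "0 < \<delta>1" "\<delta>1 \<le> \<delta>2"
  shows "occ_prob E \<delta>1 n A x c \<le> (\<delta>2 / \<delta>1) ^ card (- A) * occ_prob E \<delta>2 n A x c"
proof (induction n arbitrary: A x c)
  case 0
  have "1 \<le> (\<delta>2 / \<delta>1) ^ card (- A)" using assms by (intro one_le_power) simp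
  then show ?case by simp
next
  case (Suc n)
  let ?r = "\<delta>2 / \<delta>1" and ?c = "c - {#x#}"
  have d2: "\<delta>2 > 0" using assms by simp
  have "trans_prob E \<delta>1 A x y * occ_prob E \<delta>1 n (insert {x, y} A) y ?c
      \<le> ?r ^ card (- A) * (trans_prob E \<delta>2 A x y * occ_prob E \<delta>2 n (insert {x, y} A) y ?c)" for y
  proof -
    let ?k = "if {x, y} \<in> A then 1 else ?r"
    have "trans_prob E \<delta>1 A x y * occ_prob E \<delta>1 n (insert {x, y} A) y ?c
      \<le> (?k * trans_prob E \<delta>2 A x y) * (?r ^ card (- insert {x, y} A) * occ_prob E \<delta>2 n (insert {x, y} A) y ?c)"
      using assms d2 by (intro mult_mono trans_prob_le_new_edge_factor Suc) (auto simp: trans_prob_nonneg occ_prob_nonneg)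
    also have "\<dots> = (?k * ?r ^ card (- insert {x, y} A)) *
        (trans_prob E \<delta>2 A x y * occ_prob E \<delta>2 n (insert {x, y} A) y ?c)"
      by (simp only: mult_ac)
    \<comment> \<open>The loss at a new edge is paid for by the shrinking complement.\<close>
    also have "?k * ?r ^ card (- insert {x, y} A) = ?r ^ card (- A)"
    proof (cases "{x, y} \<in> A")
      case False
      have "- A = insert {x, y} (- insert {x, y} A)" using False by auto
      then have "card (- A) = Suc (card (- insert {x, y} A))"
        by (metis ComplI ComplD card_insert_disjoint finite insertI1)
      then show ?thesis using False by simp
    qed (simp add: insert_absorb)
    finally show ?thesis .
  qed
  then have "(\<Sum>y\<in>UNIV. trans_prob E \<delta>1 A x y * occ_prob E \<delta>1 n (insert {x, y} A) y ?c)
      \<le> ?r ^ card (- A) * (\<Sum>y\<in>UNIV. trans_prob E \<delta>2 A x y * occ_prob E \<delta>2 n (insert {x, y} A) y ?c)"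
    unfolding sum_distrib_left by (rule sum_mono)
  then show ?case by simp
qed

text \<open>In this direction every step may lose the ratio, so the rates can differ by its
  logarithm.\<close>

lemma occ_prob_le_power_ratio:
  fixes E :: "'v::finite set set"
  assumes "0 < \<delta>1" "\<delta>1 \<le> \<delta>2"
  shows "occ_prob E \<delta>2 n A x c \<le> (\<delta>2 / \<delta>1) ^ n * occ_prob E \<delta>1 n A x c"
proof (induction n arbitrary: A x c)
  case (Suc n)
  let ?r = "\<delta>2 / \<delta>1" and ?c = "c - {#x#}"
  have d2: "\<delta>2 > 0" using assms by simp
  have "trans_prob E \<delta>2 A x y * occ_prob E \<delta>2 n (insert {x, y} A) y ?c
      \<le> ?r ^ Suc n * (trans_prob E \<delta>1 A x y * occ_prob E \<delta>1 n (insert {x, y} A) y ?c)" for y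
  proof -
    have "trans_prob E \<delta>2 A x y * occ_prob E \<delta>2 n (insert {x, y} A) y ?c
      \<le> (?r * trans_prob E \<delta>1 A x y) * (?r ^ n * occ_prob E \<delta>1 n (insert {x, y} A) y ?c)"
      using assms d2 by (intro mult_mono trans_prob_le_new_edge_factor Suc) (auto simp: trans_prob_nonneg occ_prob_nonneg)
    also have "\<dots> = ?r ^ Suc n * (trans_prob E \<delta>1 A x y * occ_prob E \<delta>1 n (insert {x, y} A) y ?c)"
      by (simp only: mult_ac power_Suc)
    finally show ?thesis .
  qed
  then have "(\<Sum>y\<in>UNIV. trans_prob E \<delta>2 A x y * occ_prob E \<delta>2 n (insert {x, y} A) y ?c)
      \<le> ?r ^ Suc n * (\<Sum>y\<in>UNIV. trans_prob E \<delta>1 A x y * occ_prob E \<delta>1 n (insert {x, y} A) y ?c)"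
    unfolding sum_distrib_left by (rule sum_mono)
  then show ?case by simp
qed simp

text \<open>A fixed prefix \<open>c0\<close> and a constant factor do not change exponential rates:
  the prefix is diluted in a long walk, and the gap between \<open>h\<close> and \<open>h'\<close>
  absorbs the factor.\<close>

lemma achievable_transfer:
  fixes E :: "'v::finite set set" and h h' :: real
  assumes ach: "achievable E \<delta>' x0 \<nu> h" and \<delta>: "\<delta>' > 0" and h': "h < h'" and \<kappa>: "\<kappa> > 0"
    and le: "\<And>c. \<kappa> * occ_prob E \<delta>' (size c) {} x0 c \<le> occ_prob E \<delta> (size c0 + size c) {} x0 (c0 + c)"
  shows "achievable E \<delta> x0 \<nu> h'"
  unfolding achievable_def
proof (intro allI impI)
  fix \<epsilon> :: real and N assume e: "\<epsilon> > 0"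
  have h0: "h \<ge> 0" using achievable_nonneg[OF \<delta> ach] .
  \<comment> \<open>Beyond \<open>N1\<close> the slack \<open>n * (h' - h)\<close> outweighs
    \<open>- ln \<kappa>\<close>; beyond \<open>N2\<close> the prefix moves frequencies by less than
    half the tolerance.\<close>
  obtain N1 :: nat where N1: "- ln \<kappa> / (h' - h) \<le> N1" using real_arch_simple by blast
  obtain N2 :: nat where N2: "size c0 / (\<epsilon> / 2) < N2" using reals_Archimedean2 by blast
  obtain c where c: "max (max N 1) (max N1 N2) \<le> size c" "\<And>v. \<bar>count c v / size c - pmf \<nu> v\<bar> < \<epsilon> / 2"
    "exp (- (real (size c) * h)) \<le> occ_prob E \<delta>' (size c) {} x0 c"
    using ach e unfolding achievable_def by (meson half_gt_zero)
  define n where "n = real (size c)"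
  define n0 where "n0 = real (size c0)"
  have n: "n \<ge> 1" "n \<ge> N1" "n \<ge> N2" and n0: "n0 \<ge> 0" using c(1) by (auto simp: n_def n0_def)
  have "- ln \<kappa> \<le> n * (h' - h)"
    using N1 n(2) h' pos_divide_le_eq[of "h' - h" "- ln \<kappa>" n] by linarith
  moreover have "n0 * h' \<ge> 0" using n0 h0 h' by simp
  ultimately have "- ((n0 + n) * h') \<le> ln \<kappa> + - (n * h)" by (simp add: algebra_simps)
  then have "exp (- ((n0 + n) * h')) \<le> exp (ln \<kappa> + - (n * h))" by (simp only: exp_le_cancel_iff)
  also have "\<dots> = \<kappa> * exp (- (n * h))" using \<kappa> by (simp only: exp_add exp_ln)
  also have "\<dots> \<le> \<kappa> * occ_prob E \<delta>' (size c) {} x0 c" using c(3) \<kappa> by (simp add: n_def)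
  also note le
  finally have ex: "exp (- (real (size (c0 + c)) * h')) \<le> occ_prob E \<delta> (size (c0 + c)) {} x0 (c0 + c)"
    by (simp add: n_def n0_def)
  have "\<bar>count (c0 + c) v / size (c0 + c) - pmf \<nu> v\<bar> < \<epsilon>" for v
  proof -
    define a0 where "a0 = real (count c0 v)"
    define a where "a = real (count c v)"
    have a: "0 \<le> a0" "a0 \<le> n0" "0 \<le> a" "a \<le> n"
      by (auto simp: a0_def a_def n_def n0_def count_le_size)
    have "(a0 + a) / (n0 + n) - a / n = (n * a0 - n0 * a) / ((n0 + n) * n)"
      using n n0 by (simp add: field_simps)
    also have "\<bar>\<dots>\<bar> = \<bar>n * a0 - n0 * a\<bar> / ((n0 + n) * n)" using n n0 by (simp add: abs_mult)
    also have "\<bar>n * a0 - n0 * a\<bar> / ((n0 + n) * n) \<le> (n0 * n) / ((n0 + n) * n)"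
    proof (rule divide_right_mono)
      have "n * a0 \<le> n * n0" "n0 * a \<le> n0 * n" "0 \<le> n * a0" "0 \<le> n0 * a"
        using a n n0 by (auto intro: mult_left_mono)
      then show "\<bar>n * a0 - n0 * a\<bar> \<le> n0 * n" by (simp add: abs_le_iff mult.commute)
    qed (use n n0 in simp)
    also have "\<dots> = n0 / (n0 + n)" using n n0 by simp
    also have "\<dots> \<le> n0 / n" using n n0 by (intro divide_left_mono) auto
    also have "\<dots> < \<epsilon> / 2"
    proof -
      have "n0 / (\<epsilon> / 2) < n" using N2 n(3) by (simp add: n0_def)
      then show ?thesis using e n(1) by (simp add: field_simps)
    qed
    finally have "\<bar>(a0 + a) / (n0 + n) - a / n\<bar> < \<epsilon> / 2" .
    moreover have "\<bar>a / n - pmf \<nu> v\<bar> < \<epsilon> / 2" unfolding a_def n_def by (rule c(2))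
    ultimately have "\<bar>(a0 + a) / (n0 + n) - pmf \<nu> v\<bar> < \<epsilon>" by linarith
    then show ?thesis by (simp add: a0_def a_def n0_def n_def)
  qed
  then show "\<exists>c. N \<le> size c \<and> (\<forall>v. \<bar>count c v / size c - pmf \<nu> v\<bar> < \<epsilon>) \<and>
      exp (- (real (size c) * h')) \<le> occ_prob E \<delta> (size c) {} x0 c"
    using ex c(1) by (intro exI[of _ "c0 + c"]) auto
qed

lemma rate_le_shift:
  fixes s :: real
  assumes "\<And>h h'. achievable E \<delta>' x0 \<nu> h \<Longrightarrow> h < h' \<Longrightarrow> achievable E \<delta> x0 \<nu> (h' + s)"
  shows "rate E \<delta> x0 \<nu> \<le> rate E \<delta>' x0 \<nu> + ereal s"
proof (rule ccontr)
  assume "\<not> ?thesis"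
  then have "rate E \<delta>' x0 \<nu> + ereal s < rate E \<delta> x0 \<nu>" by (simp only: not_le)
  then have "rate E \<delta>' x0 \<nu> < rate E \<delta> x0 \<nu> - ereal s"
    by (simp add: ereal_less_minus_iff)
  then obtain h where h: "achievable E \<delta>' x0 \<nu> h" "ereal h < rate E \<delta> x0 \<nu> - ereal s"
    unfolding rate_less_iff by blast
  from ereal_dense2[OF h(2)] obtain h' where h': "h < h'" "ereal h' < rate E \<delta> x0 \<nu> - ereal s" by auto
  have "rate E \<delta> x0 \<nu> \<le> ereal (h' + s)" by (rule rate_le[OF assms[OF h(1) h'(1)]])
  moreover have "ereal h' + ereal s < rate E \<delta> x0 \<nu>" using h'(2) by (simp add: ereal_less_minus_iff)
  ultimately show False by simp
qed

lemma rate_antimono: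
  assumes "0 < \<delta>1" "\<delta>1 \<le> \<delta>2"
  shows "rate E \<delta>2 x0 \<nu> \<le> rate E \<delta>1 x0 \<nu>"
proof -
  define k where "k = (\<delta>2 / \<delta>1) ^ card (- {} :: 'a set set)"
  have k: "k > 0" unfolding k_def using assms by (intro zero_less_power) simp
  have "achievable E \<delta>2 x0 \<nu> (h' + 0)" if "achievable E \<delta>1 x0 \<nu> h" "h < h'" for h h'
  proof (simp, rule achievable_transfer[OF that(1) assms(1) that(2), where \<kappa> = "1 / k" and ?c0.0 = "{#}"])
    fix c
    show "1 / k * occ_prob E \<delta>1 (size c) {} x0 c \<le> occ_prob E \<delta>2 (size {#} + size c) {} x0 ({#} + c)"
      using occ_prob_mono_reinforcement[OF assms, of E "size c" "{}" x0 c, folded k_def] k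
      by (simp add: field_simps)
  qed (use k in simp)
  then have "rate E \<delta>2 x0 \<nu> \<le> rate E \<delta>1 x0 \<nu> + ereal 0" by (rule rate_le_shift)
  then show ?thesis by simp
qed

lemma rate_lipschitz:
  assumes "0 < \<delta>1" "\<delta>1 \<le> \<delta>2"
  shows "rate E \<delta>1 x0 \<nu> \<le> rate E \<delta>2 x0 \<nu> + ereal (ln (\<delta>2 / \<delta>1))"
proof (rule rate_le_shift)
  fix h h' :: real assume h: "achievable E \<delta>2 x0 \<nu> h" "h < h'"
  show "achievable E \<delta>1 x0 \<nu> (h' + ln (\<delta>2 / \<delta>1))"
    unfolding achievable_def
  proof (intro allI impI)
    fix \<epsilon> :: real and N assume "\<epsilon> > 0"
    then obtain c where c: "N \<le> size c" "\<forall>v. \<bar>count c v / size c - pmf \<nu> v\<bar> < \<epsilon>"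
      "exp (- (real (size c) * h')) \<le> occ_prob E \<delta>2 (size c) {} x0 c"
      using achievable_mono[OF h(1) less_imp_le[OF h(2)]] unfolding achievable_def by blast
    have r: "\<delta>2 / \<delta>1 > 0" using assms by simp
    have "exp (- (real (size c) * (h' + ln (\<delta>2 / \<delta>1)))) = exp (- (real (size c) * h')) / (\<delta>2 / \<delta>1) ^ size c"
      using r by (simp add: distrib_left exp_diff exp_of_nat_mult)
    also have "\<dots> \<le> occ_prob E \<delta>2 (size c) {} x0 c / (\<delta>2 / \<delta>1) ^ size c"
      using r c(3) by (intro divide_right_mono) (auto intro: less_imp_le)
    also have "\<dots> \<le> occ_prob E \<delta>1 (size c) {} x0 c"
      using occ_prob_le_power_ratio[OF assms, of E "size c" "{}" x0 c] r
      by (subst pos_divide_le_eq) (auto simp only: zero_less_power mult.commute)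
    finally show "\<exists>c. N \<le> size c \<and> (\<forall>v. \<bar>count c v / size c - pmf \<nu> v\<bar> < \<epsilon>) \<and>
        exp (- (real (size c) * (h' + ln (\<delta>2 / \<delta>1)))) \<le> occ_prob E \<delta>1 (size c) {} x0 c"
      using c by blast
  qed
qed

text \<open>Finiteness does not depend on \<delta>: by the logarithmic bound the function is either
  constantly \<infinity> or real-valued on \<open>{1..}\<close>. In the latter case it is
  1-Lipschitz, as \<open>ln (b / a) \<le> b - a\<close> for
  \<open>1 \<le> a \<le> b\<close>.\<close>

lemma rate_continuous_on: "continuous_on {1..} (\<lambda>\<delta>. rate E \<delta> x0 \<nu>)"
proof (cases "rate E 1 x0 \<nu> = \<infinity>")
  case True
  have "rate E \<delta> x0 \<nu> = \<infinity>" if "\<delta> \<ge> 1" for \<delta>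
    using rate_lipschitz[of 1 \<delta> E x0 \<nu>] that True by auto
  then show ?thesis
    by (intro continuous_on_eq[OF continuous_on_const[of _ "\<infinity> :: ereal"]]) simp
next
  case False
  define g where "g = (\<lambda>\<delta>. real_of_ereal (rate E \<delta> x0 \<nu>))"
  have g: "rate E \<delta> x0 \<nu> = ereal (g \<delta>)" if "\<delta> \<ge> 1" for \<delta>
  proof -
    have "rate E \<delta> x0 \<nu> \<noteq> \<infinity>" using rate_antimono[of 1 \<delta> E x0 \<nu>] that False by auto
    moreover have "0 \<le> rate E \<delta> x0 \<nu>" using that by (intro rate_nonneg) simp
    ultimately show ?thesis by (auto simp: g_def ereal_real)
  qed
  have lip: "\<bar>g b - g a\<bar> \<le> b - a" if "1 \<le> a" "a \<le> b" for a b
  proof -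
    have "ln (b / a) \<le> b / a - 1" using that by (intro ln_le_minus_one) simp
    also have "\<dots> = (b - a) / a" using that by (simp add: field_simps)
    also have "\<dots> \<le> (b - a) / 1" using that by (intro divide_left_mono) auto
    finally have "ln (b / a) \<le> b - a" by simp
    moreover have "g a \<le> g b + ln (b / a)"
      using rate_lipschitz[of a b E x0 \<nu>] that by (simp add: g)
    moreover have "g b \<le> g a" using rate_antimono[of a b E x0 \<nu>] that by (simp add: g)
    ultimately show ?thesis by linarith
  qed
  have "1-lipschitz_on {1..} g"
  proof (rule lipschitz_onI)
    fix a b :: real assume "a \<in> {1..}" "b \<in> {1..}"
    then show "dist (g a) (g b) \<le> 1 * dist a b"
      using lip[of a b] lip[of b a] by (cases "a \<le> b") (auto simp: dist_real_def)
  qed simp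
  then have "continuous_on {1..} (\<lambda>\<delta>. ereal (g \<delta>))"
    by (intro continuous_on_ereal lipschitz_on_continuous_on)
  then show ?thesis by (rule continuous_on_eq) (simp add: g)
qed

text \<open>Some fixed finite path with departure points \<open>c0\<close> leads from the state
  \<open>(A, x)\<close> to \<open>(A', y)\<close>. It is recorded only through its effect on all
  continuations, which is the form that \<open>achievable_transfer\<close> consumes.\<close>

definition reaches :: "'v::finite set set \<Rightarrow> real \<Rightarrow> 'v set set \<Rightarrow> 'v \<Rightarrow> 'v set set \<Rightarrow> 'v \<Rightarrow> bool" where
  "reaches E \<delta> A x A' y \<longleftrightarrow> (\<exists>\<kappa>>0. \<exists>c0. \<forall>m d.
     \<kappa> * occ_prob E \<delta> m A' y d \<le> occ_prob E \<delta> (size c0 + m) A x (c0 + d))"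

lemma reaches_refl: "reaches E \<delta> A x A x"
  unfolding reaches_def by (intro exI[of _ 1] conjI exI[of _ "{#}"]) auto

lemma reaches_step:
  assumes "\<delta> > 0" "reaches E \<delta> A x A' y" "adjacent E y z"
  shows "reaches E \<delta> A x (insert {y, z} A') z"
proof -
  obtain \<kappa> c0 where r: "\<kappa> > 0"
    "\<And>m d. \<kappa> * occ_prob E \<delta> m A' y d \<le> occ_prob E \<delta> (size c0 + m) A x (c0 + d)"
    using assms(2) unfolding reaches_def by blast
  let ?p = "trans_prob E \<delta> A' y z"
  have "(\<kappa> * ?p) * occ_prob E \<delta> m (insert {y, z} A') z d
      \<le> occ_prob E \<delta> (size (add_mset y c0) + m) A x (add_mset y c0 + d)" for m d
  proof -
    have "\<kappa> * (?p * occ_prob E \<delta> m (insert {y, z} A') z d) \<le> \<kappa> * occ_prob E \<delta> (Suc m) A' y (add_mset y d)"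
      using occ_prob_step[OF assms(1)] r(1) by (intro mult_left_mono) auto
    also have "\<dots> \<le> occ_prob E \<delta> (size c0 + Suc m) A x (c0 + add_mset y d)" by (rule r(2))
    finally show ?thesis by (simp add: mult.assoc)
  qed
  moreover have "\<kappa> * ?p > 0" using r(1) trans_prob_pos[OF assms(1,3)] by simp
  ultimately show ?thesis unfolding reaches_def by blast
qed

lemma reaches_vertex:
  assumes \<delta>: "\<delta> > 0" and r: "reaches E \<delta> A x A' y" and "(adjacent E)\<^sup>*\<^sup>* y z"
  shows "\<exists>A''. A' \<subseteq> A'' \<and> reaches E \<delta> A x A'' z"
  using assms(3)
proof induction
  case (step z w)
  then show ?case using reaches_step[OF \<delta>] by (meson order_trans subset_insertI)
qed (use r in blast)

text \<open>Edge by edge: walk to an end of the next edge and cross it. At last the walk returns to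
  \<open>x\<close>, because the walk it is compared with afterwards starts there.\<close>

lemma reaches_cover:
  fixes E :: "'v::finite set set"
  assumes \<delta>: "\<delta> > 0" and E: "simple_graph E" "connected_graph E"
  shows "\<exists>A. E \<subseteq> A \<and> reaches E \<delta> {} x A x"
proof -
  have "\<exists>A y. F \<subseteq> A \<and> reaches E \<delta> {} x A y" if "F \<subseteq> E" for F
    using finite[of F] that
  proof induction
    case empty
    then show ?case using reaches_refl by blast
  next
    case (insert e F)
    then obtain A y where A: "F \<subseteq> A" "reaches E \<delta> {} x A y" by auto
    obtain u v where e: "e = {u, v}" using E(1) insert.prems by (auto simp: simple_graph_def)
    then have adj: "adjacent E u v" using insert.prems by (simp add: adjacent_def)
    have "(adjacent E)\<^sup>*\<^sup>* y u" using E(2) by (simp add: connected_graph_def)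
    from reaches_vertex[OF \<delta> A(2) this] obtain A' where "A \<subseteq> A'" "reaches E \<delta> {} x A' u" by blast
    then have "reaches E \<delta> {} x (insert {u, v} A') v" by (intro reaches_step[OF \<delta> _ adj])
    moreover have "insert e F \<subseteq> insert {u, v} A'" using A(1) \<open>A \<subseteq> A'\<close> e by auto
    ultimately show ?case by blast
  qed
  then obtain A y where A: "E \<subseteq> A" "reaches E \<delta> {} x A y" by blast
  have "(adjacent E)\<^sup>*\<^sup>* y x" using E(2) by (simp add: connected_graph_def)
  from reaches_vertex[OF \<delta> A(2) this] show ?thesis using A(1) by blast
qed

text \<open>Once every edge is traversed, the common weight \<delta> cancels and a simple random
  walk remains. For reinforcement 1 the traversed set has no influence, hence the arbitrary
  \<open>A\<close> on the right.\<close>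

lemma occ_prob_covered:
  fixes E :: "'v::finite set set"
  assumes "\<delta> > 0" "E \<subseteq> A'"
  shows "occ_prob E \<delta> n A' x c = occ_prob E 1 n A x c"
  using assms(2)
proof (induction n arbitrary: A' A x c)
  case (Suc n)
  have "trans_prob E \<delta> A' x y = trans_prob E 1 A x y" for y
  proof -
    have "(\<Sum>u | adjacent E x u. if {x, u} \<in> A' then \<delta> else 1) = (\<Sum>u | adjacent E x u. \<delta>)"
      using Suc.prems by (intro sum.cong) (auto simp: adjacent_def)
    moreover have "{x, y} \<in> A'" if "adjacent E x y" using Suc.prems that by (auto simp: adjacent_def)
    ultimately show ?thesis using assms(1) by (simp add: trans_prob_def)
  qed
  moreover have "occ_prob E \<delta> n (insert {x, y} A') y (c - {#x#}) = occ_prob E 1 n (insert {x, y} A) y (c - {#x#})" for y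
    using Suc.prems by (intro Suc.IH) auto
  ultimately show ?case by simp
qed simp

text \<open>Covering the graph at bounded cost gives \<open>\<le>\<close>; the assumption
  \<open>\<delta> \<le> 1\<close> enters in the other direction, by monotonicity.\<close>

lemma rate_eq_rate_1:
  fixes E :: "'v::finite set set"
  assumes \<delta>: "0 < \<delta>" "\<delta> \<le> 1" and E: "simple_graph E" "connected_graph E"
  shows "rate E \<delta> x0 \<nu> = rate E 1 x0 \<nu>"
proof (rule antisym)
  obtain A where A: "E \<subseteq> A" "reaches E \<delta> {} x0 A x0" using reaches_cover[OF \<delta>(1) E] by blast
  then obtain \<kappa> c0 where r: "\<kappa> > 0"
    "\<And>m d. \<kappa> * occ_prob E \<delta> m A x0 d \<le> occ_prob E \<delta> (size c0 + m) {} x0 (c0 + d)"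
    unfolding reaches_def by blast
  have "achievable E \<delta> x0 \<nu> (h' + 0)" if "achievable E 1 x0 \<nu> h" "h < h'" for h h'
  proof (simp, rule achievable_transfer[OF that(1) _ that(2) r(1)])
    fix c
    show "\<kappa> * occ_prob E 1 (size c) {} x0 c \<le> occ_prob E \<delta> (size c0 + size c) {} x0 (c0 + c)"
      using r(2)[of "size c" c] occ_prob_covered[OF \<delta>(1) A(1), of "size c" x0 c "{}"] by simp
  qed simp
  then have "rate E \<delta> x0 \<nu> \<le> rate E 1 x0 \<nu> + ereal 0" by (rule rate_le_shift)
  then show "rate E \<delta> x0 \<nu> \<le> rate E 1 x0 \<nu>" by simp
qed (rule rate_antimono[OF \<delta>])

section \<open>The uniform measure on an edge\<close>

definition degree :: "'v::finite set set \<Rightarrow> 'v \<Rightarrow> nat" where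
  "degree E x = card {u. adjacent E x u}"

lemma simple_adjacent_neq: "simple_graph E \<Longrightarrow> adjacent E x y \<Longrightarrow> x \<noteq> y"
  unfolding simple_graph_def adjacent_def by (metis doubleton_eq_iff)

lemma degree_pos: "adjacent E x y \<Longrightarrow> degree E x \<ge> 1"
  unfolding degree_def by (metis Suc_leI One_nat_def card_gt_0_iff empty_iff finite mem_Collect_eq)

lemma trans_prob_single_edge:
  assumes "adjacent E x y" "x \<noteq> y"
  shows "trans_prob E \<delta> {{x, y}} x y = \<delta> / (\<delta> + (degree E x - 1))"
proof -
  have "(\<Sum>u | adjacent E x u. if {x, u} \<in> {{x, y}} then \<delta> else 1)
      = (if {x, y} \<in> {{x, y}} then \<delta> else 1) + (\<Sum>u\<in>{u. adjacent E x u} - {y}. if {x, u} \<in> {{x, y}} then \<delta> else 1)"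
    using assms by (intro sum.remove) auto
  also have "(\<Sum>u\<in>{u. adjacent E x u} - {y}. if {x, u} \<in> {{x, y}} then \<delta> else 1) = (\<Sum>u\<in>{u. adjacent E x u} - {y}. 1)"
    by (intro sum.cong) (auto simp: doubleton_eq_iff)
  also have "\<dots> = real (degree E x - 1)"
    using assms by (simp add: degree_def card_Diff_singleton)
  finally show ?thesis using assms by (simp add: trans_prob_def)
qed

text \<open>For \<open>\<delta> \<ge> 1\<close> a step is most likely when its own edge has been
  traversed and no competing edge at \<open>x\<close> has; \<open>trans_prob_single_edge\<close> is
  the case of equality.\<close>

lemma trans_prob_le_single_edge:
  assumes "\<delta> \<ge> 1" "adjacent E x y"
  shows "trans_prob E \<delta> A x y \<le> \<delta> / (\<delta> + (degree E x - 1))"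
proof -
  let ?D = "\<Sum>u | adjacent E x u. if {x, u} \<in> A then \<delta> else (1::real)"
  define m where "m = real (degree E x - 1)"
  have m: "m \<ge> 0" by (simp add: m_def)
  have D: "?D = (if {x, y} \<in> A then \<delta> else 1) + (\<Sum>u\<in>{u. adjacent E x u} - {y}. if {x, u} \<in> A then \<delta> else 1)"
    using assms by (intro sum.remove) auto
  have "m = (\<Sum>u\<in>{u. adjacent E x u} - {y}. 1)"
    using assms by (simp add: degree_def card_Diff_singleton m_def)
  also have "\<dots> \<le> (\<Sum>u\<in>{u. adjacent E x u} - {y}. if {x, u} \<in> A then \<delta> else 1)"
    using assms by (intro sum_mono) auto
  finally have Dm: "(if {x, y} \<in> A then \<delta> else 1) + m \<le> ?D" using D by simp
  show ?thesis unfolding m_def[symmetric]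
  proof (cases "{x, y} \<in> A")
    case True
    then have "trans_prob E \<delta> A x y = \<delta> / ?D" using assms by (simp add: trans_prob_def)
    also have "\<dots> \<le> \<delta> / (\<delta> + m)" using Dm True assms(1) m by (intro divide_left_mono mult_pos_pos) auto
    finally show "trans_prob E \<delta> A x y \<le> \<delta> / (\<delta> + m)" .
  next
    case False
    then have "trans_prob E \<delta> A x y = 1 / ?D" using assms by (simp add: trans_prob_def)
    also have "\<dots> \<le> 1 / (1 + m)" using Dm False m by (intro divide_left_mono mult_pos_pos) auto
    also have "\<dots> \<le> \<delta> / (\<delta> + m)"
      using m assms(1) mult_right_mono[of 1 \<delta> m] by (simp add: field_simps)
    finally show "trans_prob E \<delta> A x y \<le> \<delta> / (\<delta> + m)" .
  qed
qed

lemma occ_prob_alternate: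
  assumes \<delta>: "\<delta> > 0"
  shows "(trans_prob E \<delta> {{x, y}} x y * trans_prob E \<delta> {{x, y}} y x) ^ k
    \<le> occ_prob E \<delta> (2 * k) {{x, y}} x (repeat_mset k {#x, y#})"
proof (induction k)
  case (Suc k)
  let ?e = "{{x, y}}" and ?c = "repeat_mset k {#x, y#}"
  let ?p = "trans_prob E \<delta> ?e x y" and ?q = "trans_prob E \<delta> ?e y x"
  have e: "insert {x, y} ?e = ?e" "insert {y, x} ?e = ?e" by auto
  have "(?p * ?q) ^ Suc k = ?p * (?q * (?p * ?q) ^ k)" by simp
  also have "\<dots> \<le> ?p * (?q * occ_prob E \<delta> (2 * k) ?e x ?c)"
    by (intro mult_left_mono Suc trans_prob_nonneg \<delta>)
  also have "\<dots> \<le> ?p * occ_prob E \<delta> (Suc (2 * k)) ?e y (add_mset y ?c)"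
    using occ_prob_step[OF \<delta>, of E ?e y x "2 * k" ?c] unfolding e
    by (intro mult_left_mono trans_prob_nonneg \<delta>)
  also have "\<dots> \<le> occ_prob E \<delta> (Suc (Suc (2 * k))) ?e x (add_mset x (add_mset y ?c))"
    using occ_prob_step[OF \<delta>, of E ?e x y "Suc (2 * k)" "add_mset y ?c"] unfolding e .
  finally show ?case by simp
qed simp

definition edge_measure :: "'v \<Rightarrow> 'v \<Rightarrow> 'v pmf" where
  "edge_measure x y = pmf_of_set {x, y}"

lemma pmf_edge_measure: "x \<noteq> y \<Longrightarrow> pmf (edge_measure x y) u = (if u = x \<or> u = y then 1 / 2 else 0)"
  by (simp add: edge_measure_def indicator_def)

text \<open>The walk oscillates along the edge. A round trip has probability \<open>p * q\<close>
  and takes two steps, whence the halved logarithm; the first crossing differs, because the edge is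
  still new.\<close>

lemma achievable_edge_measure:
  fixes E :: "'v::finite set set" and h :: real
  assumes \<delta>: "\<delta> > 0" and adj: "adjacent E x y" "x \<noteq> y"
    and h: "- ln (trans_prob E \<delta> {{x, y}} x y * trans_prob E \<delta> {{x, y}} y x) / 2 < h"
  shows "achievable E \<delta> x (edge_measure x y) h"
  unfolding achievable_def
proof (intro allI impI)
  fix \<epsilon> :: real and N assume e: "\<epsilon> > 0"
  define p where "p = trans_prob E \<delta> {{x, y}} x y"
  define q where "q = trans_prob E \<delta> {{x, y}} y x"
  define t where "t = trans_prob E \<delta> {} x y"
  have adj': "adjacent E y x" using adj(1) adjacent_commute by metis
  have pos: "p > 0" "q > 0" "t > 0" using trans_prob_pos[OF \<delta>] adj(1) adj' by (auto simp: p_def q_def t_def)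
  have le1: "p \<le> 1" "q \<le> 1" "t \<le> 1" by (auto simp: p_def q_def t_def trans_prob_le_1[OF \<delta>])
  have h2: "2 * h + ln (p * q) > 0" using h by (simp add: p_def q_def)
  \<comment> \<open>Each round trip leaves a surplus \<open>2 * h + ln (p * q)\<close>; after
    \<open>K\<close> of them it has paid for the exceptional first one, of probability
    \<open>t * q\<close>.\<close>
  obtain K :: nat where K: "- ln (t * q) / (2 * h + ln (p * q)) \<le> K" using real_arch_simple by blast
  define k where "k = N + K"
  define c where "c = repeat_mset (Suc k) {#x, y#}"
  have sz: "size c = 2 * Suc k" by (simp add: c_def)
  have "- ln (t * q) \<le> K * (2 * h + ln (p * q))"
    using K pos_divide_le_eq[OF h2, of "- ln (t * q)" "real K"] by simp
  also have "\<dots> \<le> Suc k * (2 * h + ln (p * q))" using h2 by (intro mult_right_mono) (auto simp: k_def)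
  finally have "- (real (size c) * h) \<le> ln (t * q) + Suc k * ln (p * q)"
    by (simp only: sz of_nat_mult of_nat_numeral) (simp add: algebra_simps)
  then have "exp (- (real (size c) * h)) \<le> exp (ln (t * q) + Suc k * ln (p * q))" by (simp only: exp_le_cancel_iff)
  also have "\<dots> = (t * q) * (p * q) ^ Suc k"
    using pos by (simp only: exp_add exp_of_nat_mult exp_ln mult_pos_pos)
  also have "\<dots> \<le> (t * q) * (p * q) ^ k"
    using pos le1 by (intro mult_left_mono power_decreasing mult_le_one) auto
  also have "\<dots> \<le> (t * q) * occ_prob E \<delta> (2 * k) {{x, y}} x (repeat_mset k {#x, y#})"
    using pos occ_prob_alternate[OF \<delta>, of E x y k] by (intro mult_left_mono) (auto simp: p_def q_def)
  also have "\<dots> = t * (q * occ_prob E \<delta> (2 * k) {{x, y}} x (repeat_mset k {#x, y#}))" by simp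
  also have "\<dots> \<le> t * occ_prob E \<delta> (Suc (2 * k)) {{x, y}} y (add_mset y (repeat_mset k {#x, y#}))"
    using pos occ_prob_step[OF \<delta>, of E "{{x, y}}" y x "2 * k" "repeat_mset k {#x, y#}"]
    by (intro mult_left_mono) (auto simp: q_def insert_commute)
  also have "\<dots> \<le> occ_prob E \<delta> (Suc (Suc (2 * k))) {} x (add_mset x (add_mset y (repeat_mset k {#x, y#})))"
    using occ_prob_step[OF \<delta>, of E "{}" x y "Suc (2 * k)" "add_mset y (repeat_mset k {#x, y#})"]
    by (simp only: t_def)
  also have "\<dots> = occ_prob E \<delta> (size c) {} x c"
  proof -
    have "add_mset x (add_mset y (repeat_mset k {#x, y#})) = c" by (simp add: c_def)
    moreover have "Suc (Suc (2 * k)) = size c" by (simp add: sz)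
    ultimately show ?thesis by (simp only:)
  qed
  finally have "exp (- (real (size c) * h)) \<le> occ_prob E \<delta> (size c) {} x c" .
  moreover have "\<bar>count c v / size c - pmf (edge_measure x y) v\<bar> < \<epsilon>" for v
  proof -
    have "real (count c v) = (if v = x \<or> v = y then real (Suc k) else 0)" using adj(2) by (auto simp: c_def)
    then have "count c v / size c = pmf (edge_measure x y) v"
      unfolding sz pmf_edge_measure[OF adj(2)] by (simp add: field_simps)
    then show ?thesis using e by simp
  qed
  moreover have "N \<le> size c" by (simp add: sz k_def)
  ultimately show "\<exists>c. N \<le> size c \<and> (\<forall>v. \<bar>count c v / size c - pmf (edge_measure x y) v\<bar> < \<epsilon>) \<and>
      exp (- (real (size c) * h)) \<le> occ_prob E \<delta> (size c) {} x c" by blast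
qed

text \<open>A discrete Feynman-Kac bound: \<open>f\<close> is the weight of a visit and \<open>u\<close> a supersolution.\<close>

lemma occ_prob_potential_bound:
  fixes E :: "'v::finite set set" and f u :: "'v \<Rightarrow> real"
  assumes \<delta>: "\<delta> > 0" and pos: "\<And>x. 0 < f x" "0 < \<theta>" "\<And>x. \<theta> \<le> u x" "0 < \<rho>"
    and super: "\<And>A x. f x * (\<Sum>y\<in>UNIV. trans_prob E \<delta> A x y * u y) \<le> \<rho> * u x"
  shows "prod_mset (image_mset f c) * occ_prob E \<delta> n A x c \<le> \<rho> ^ n * u x / \<theta>"
proof (induction n arbitrary: A x c)
  case 0
  then show ?case using pos(3)[of x] pos(2) by auto
next
  case (Suc n)
  show ?case
  proof (cases "x \<in># c")
    case True
    then obtain d where c: "c = add_mset x d" by (metis mset_add)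
    let ?F = "prod_mset (image_mset f d)"
    have "prod_mset (image_mset f c) * occ_prob E \<delta> (Suc n) A x c
        = f x * (\<Sum>y\<in>UNIV. trans_prob E \<delta> A x y * (?F * occ_prob E \<delta> n (insert {x, y} A) y d))"
      by (simp add: c sum_distrib_left mult_ac)
    also have "\<dots> \<le> f x * (\<Sum>y\<in>UNIV. trans_prob E \<delta> A x y * (\<rho> ^ n * u y / \<theta>))"
      using pos(1)[of x] by (intro mult_left_mono sum_mono Suc trans_prob_nonneg \<delta>) auto
    also have "\<dots> = \<rho> ^ n / \<theta> * (f x * (\<Sum>y\<in>UNIV. trans_prob E \<delta> A x y * u y))"
      by (simp add: sum_distrib_left mult_ac)
    also have "\<dots> \<le> \<rho> ^ n / \<theta> * (\<rho> * u x)"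
      using pos by (intro mult_left_mono super) auto
    also have "\<dots> = \<rho> ^ Suc n * u x / \<theta>" by simp
    finally show ?thesis .
  next
    case False
    have "0 \<le> \<rho> ^ Suc n * u x / \<theta>" using pos(2,4) pos(3)[of x] by simp
    then show ?thesis using False by simp
  qed
qed

text \<open>Multisets near the edge measure have few visits off \<open>{x, y}\<close>, so damping
  those visits by a factor \<open>s\<close> changes little. With this damping, the potential bound
  shows that the probability decays at least like the powers of \<rho>.\<close>

lemma edge_measure_lower_bound:
  fixes E :: "'v::finite set set" and h :: real
  assumes \<delta>: "\<delta> > 0" and sg: "simple_graph E" and xy: "x \<noteq> y"
    and pq: "0 < p" "p \<le> 1" "0 < q" "q \<le> 1"
      "\<And>A. trans_prob E \<delta> A x y \<le> p" "\<And>A. trans_prob E \<delta> A y x \<le> q"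
    and \<rho>: "sqrt (p * q) < \<rho>"
    and ach: "achievable E \<delta> x (edge_measure x y) h"
  shows "- ln \<rho> \<le> h"
proof (rule ccontr)
  assume neg: "\<not> - ln \<rho> \<le> h"
  define a where "a = sqrt p"
  define b where "b = sqrt q"
  have a: "0 < a" "a \<le> 1" "a * a = p" and b: "0 < b" "b \<le> 1" "b * b = q"
    using pq by (auto simp: a_def b_def)
  have ab: "a * b < \<rho>" using \<rho> by (simp add: a_def b_def real_sqrt_mult)
  \<comment> \<open>The room above \<open>a * b\<close>; it pays for leakage to the other vertices,
    where the supersolution has the small value \<theta>.\<close>
  define \<eta> where "\<eta> = \<rho> - a * b"
  \<comment> \<open>The vector \<open>(a, b)\<close> is the Perron eigenvector of the two-state kernel that alternates with
    weights \<open>p\<close> and \<open>q\<close>; its eigenvalue is \<open>a * b\<close>.\<close>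
  define \<theta> where "\<theta> = min a b * min 1 \<eta>"
  have \<eta>: "\<eta> > 0" using ab by (simp add: \<eta>_def)
  have \<theta>0: "\<theta> > 0" using a b \<eta> by (simp add: \<theta>_def)
  have \<theta>ab: "\<theta> \<le> a" "\<theta> \<le> b" "\<theta> \<le> \<eta> * a" "\<theta> \<le> \<eta> * b"
  proof -
    have "min a b * min 1 \<eta> \<le> a * 1" "min a b * min 1 \<eta> \<le> b * 1"
      "min a b * min 1 \<eta> \<le> a * \<eta>" "min a b * min 1 \<eta> \<le> b * \<eta>"
      using a b \<eta> by (intro mult_mono; simp)+
    then show "\<theta> \<le> a" "\<theta> \<le> b" "\<theta> \<le> \<eta> * a" "\<theta> \<le> \<eta> * b" by (simp_all add: \<theta>_def mult.commute)
  qed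
  have \<rho>0: "\<rho> > 0" using ab a b by (smt (verit) mult_pos_pos)
  \<comment> \<open>The damping must give \<open>s * 1 \<le> \<rho> * \<theta>\<close>, the
    supersolution inequality off the edge.\<close>
  define s where "s = min 1 (\<rho> * \<theta>)"
  have s: "0 < s" "s \<le> 1" "s \<le> \<rho> * \<theta>" using \<rho>0 \<theta>0 by (auto simp: s_def)
  define u where "u = (\<lambda>z. if z = x then a else if z = y then b else \<theta>)"
  define f where "f = (\<lambda>z. if z = x \<or> z = y then 1 else s)"
  have u: "\<theta> \<le> u z" "u z \<le> 1" for z using \<theta>ab a b by (auto simp: u_def)
  have self: "trans_prob E \<delta> A z z = 0" for A z
    using simple_adjacent_neq[OF sg, of z z] by (intro trans_prob_eq_0) blast
  have super: "f z * (\<Sum>w\<in>UNIV. trans_prob E \<delta> A z w * u w) \<le> \<rho> * u z" for A z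
  proof -
    let ?t = "trans_prob E \<delta> A z"
    have rest: "(\<Sum>w\<in>UNIV - {v}. ?t w * \<theta>) \<le> \<theta>" for v
    proof -
      have "(\<Sum>w\<in>UNIV - {v}. ?t w * \<theta>) \<le> (\<Sum>w\<in>UNIV. ?t w * \<theta>)"
        using \<theta>0 by (intro sum_mono2) (auto simp: trans_prob_nonneg[OF \<delta>])
      also have "\<dots> = (\<Sum>w\<in>UNIV. ?t w) * \<theta>" by (simp add: sum_distrib_right)
      also have "\<dots> \<le> 1 * \<theta>" using \<theta>0 sum_trans_prob_le[OF \<delta>, of E A z] by (intro mult_right_mono) auto
      finally show ?thesis by simp
    qed
    consider "z = x" | "z = y" | "z \<noteq> x" "z \<noteq> y" by blast
    then show ?thesis
    proof cases
      case 1
      have "(\<Sum>w\<in>UNIV. ?t w * u w) = ?t y * u y + (\<Sum>w\<in>UNIV - {y}. ?t w * u w)"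
        by (intro sum.remove) auto
      also have "(\<Sum>w\<in>UNIV - {y}. ?t w * u w) = (\<Sum>w\<in>UNIV - {y}. ?t w * \<theta>)"
        using 1 self by (intro sum.cong) (auto simp: u_def)
      also have "?t y * u y + \<dots> \<le> p * b + \<theta>"
        using 1 rest[of y] pq(1) pq(5)[of A] b xy by (intro add_mono mult_mono) (auto simp: u_def)
      also have "\<dots> \<le> a * (a * b) + \<eta> * a" using \<theta>ab a(3) by (simp add: mult.assoc[symmetric])
      also have "\<dots> = \<rho> * a" by (simp add: \<eta>_def algebra_simps)
      finally show ?thesis using 1 by (simp add: f_def u_def)
    next
      case 2
      have "(\<Sum>w\<in>UNIV. ?t w * u w) = ?t x * u x + (\<Sum>w\<in>UNIV - {x}. ?t w * u w)"
        by (intro sum.remove) auto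
      also have "(\<Sum>w\<in>UNIV - {x}. ?t w * u w) = (\<Sum>w\<in>UNIV - {x}. ?t w * \<theta>)"
        using 2 self by (intro sum.cong) (auto simp: u_def)
      also have "?t x * u x + \<dots> \<le> q * a + \<theta>"
        using 2 rest[of x] pq(3) pq(6)[of A] a xy by (intro add_mono mult_mono) (auto simp: u_def)
      also have "\<dots> \<le> b * (b * a) + \<eta> * b" using \<theta>ab b(3) by (simp add: mult.assoc[symmetric])
      also have "\<dots> = \<rho> * b" by (simp add: \<eta>_def algebra_simps)
      finally show ?thesis using 2 xy by (simp add: f_def u_def)
    next
      case 3
      have "(\<Sum>w\<in>UNIV. ?t w * u w) \<le> (\<Sum>w\<in>UNIV. ?t w * 1)"
        using u by (intro sum_mono mult_left_mono) (auto simp: trans_prob_nonneg[OF \<delta>])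
      also have "\<dots> \<le> 1" using sum_trans_prob_le[OF \<delta>, of E A z] by simp
      finally have "s * (\<Sum>w\<in>UNIV. ?t w * u w) \<le> s * 1" using s by (intro mult_left_mono) auto
      also have "s * 1 \<le> \<rho> * u z" using 3 s by (simp add: u_def)
      finally show ?thesis using 3 by (simp add: f_def)
    qed
  qed
  have bound: "prod_mset (image_mset f c) * occ_prob E \<delta> n A x c \<le> \<rho> ^ n / \<theta>" for n A c
  proof -
    have "f z > 0" for z using s by (simp add: f_def)
    from occ_prob_potential_bound[OF \<delta> this \<theta>0 u(1) \<rho>0 super, of c n A x]
    have "prod_mset (image_mset f c) * occ_prob E \<delta> n A x c \<le> \<rho> ^ n * u x / \<theta>" .
    also have "\<dots> \<le> \<rho> ^ n * 1 / \<theta>" using u \<rho>0 \<theta>0 by (intro divide_right_mono mult_left_mono) auto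
    finally show ?thesis by simp
  qed
  \<comment> \<open>The product is \<open>s\<close> to the number of visits off the edge, stated
    without subtraction.\<close>
  have prod_f: "prod_mset (image_mset f c) * s ^ (count c x + count c y) = s ^ size c" for c
    using xy s by (induction c) (auto simp: f_def)
  define \<gamma> where "\<gamma> = - ln \<rho> - h"
  have \<gamma>: "\<gamma> > 0" using neg by (simp add: \<gamma>_def)
  define l where "l = - ln s"
  have l: "l \<ge> 0" using s by (simp add: l_def)
  \<comment> \<open>The fraction of visits off the edge is below \<open>2 * \<epsilon>\<close>, and
    each costs \<open>l\<close>; with this choice they use up at most half of the gap \<gamma>.
    \<open>l + 1\<close> allows for \<open>l = 0\<close>.\<close>
  define \<epsilon> where "\<epsilon> = \<gamma> / (4 * (l + 1))"
  have \<epsilon>: "\<epsilon> > 0" using \<gamma> l by (simp add: \<epsilon>_def)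
  \<comment> \<open>The other half of the gap has to beat the constant
    \<open>- ln \<theta>\<close>.\<close>
  obtain N :: nat where N: "2 * - ln \<theta> / \<gamma> < N" using reals_Archimedean2 by blast
  obtain c where c: "max 1 N \<le> size c" "\<And>v. \<bar>count c v / size c - pmf (edge_measure x y) v\<bar> < \<epsilon>"
    "exp (- (real (size c) * h)) \<le> occ_prob E \<delta> (size c) {} x c"
    using ach \<epsilon> unfolding achievable_def by meson
  define n where "n = real (size c)"
  have n: "n \<ge> 1" "n \<ge> N" using c(1) by (auto simp: n_def)
  define k where "k = count c x + count c y"
  have "count c x / n > 1 / 2 - \<epsilon>" "count c y / n > 1 / 2 - \<epsilon>"
    using c(2)[of x] c(2)[of y] by (auto simp: pmf_edge_measure[OF xy] n_def)
  then have "k / n > 1 - 2 * \<epsilon>" by (simp add: k_def add_divide_distrib)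
  then have k: "n - k < 2 * \<epsilon> * n" using n(1) by (simp add: field_simps)
  have W: "occ_prob E \<delta> (size c) {} x c > 0" using c(3) by (meson exp_gt_zero less_le_trans)
  have "s ^ size c * occ_prob E \<delta> (size c) {} x c
      = s ^ k * (prod_mset (image_mset f c) * occ_prob E \<delta> (size c) {} x c)"
    by (simp add: prod_f[of c, symmetric] k_def)
  also have "\<dots> \<le> s ^ k * (\<rho> ^ size c / \<theta>)"
    using s by (intro mult_left_mono bound) auto
  finally have "ln (s ^ size c * occ_prob E \<delta> (size c) {} x c) \<le> ln (s ^ k * (\<rho> ^ size c / \<theta>))"
    using s W by (subst ln_le_cancel_iff) (auto simp: \<rho>0 \<theta>0)
  then have "n * ln s + ln (occ_prob E \<delta> (size c) {} x c) \<le> k * ln s + (n * ln \<rho> - ln \<theta>)"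
    using s W \<rho>0 \<theta>0 by (simp add: ln_mult ln_realpow ln_div n_def)
  moreover have "- (n * h) \<le> ln (occ_prob E \<delta> (size c) {} x c)"
    using c(3) W by (simp add: ln_ge_iff n_def)
  ultimately have "n * \<gamma> \<le> (n - k) * l - ln \<theta>" by (simp add: \<gamma>_def l_def algebra_simps)
  also have "(n - k) * l \<le> (2 * \<epsilon> * n) * l" using k l by (intro mult_right_mono) auto
  also have "\<dots> \<le> n * \<gamma> / 2"
  proof -
    have "\<epsilon> * l \<le> \<gamma> / 4" using \<gamma> l by (simp add: \<epsilon>_def field_simps)
    then have "(2 * n) * (\<epsilon> * l) \<le> (2 * n) * (\<gamma> / 4)" using n by (intro mult_left_mono) auto
    then show ?thesis by (simp add: mult_ac)
  qed
  finally have "n * \<gamma> / 2 \<le> - ln \<theta>" by simp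
  moreover have "- ln \<theta> < n * \<gamma> / 2"
  proof -
    have "2 * - ln \<theta> / \<gamma> < n" using N n(2) by linarith
    then show ?thesis using \<gamma> by (simp add: field_simps)
  qed
  ultimately show False by simp
qed

text \<open>Equal to \<open>- ln (p * q) / 2\<close> for
  \<open>p = \<delta> / (\<delta> + a)\<close> and \<open>q = \<delta> / (\<delta> + b)\<close>, the
  crossing probabilities of the edge when its ends have \<open>a\<close> and \<open>b\<close> other,
  untraversed edges.\<close>

definition edge_rate :: "real \<Rightarrow> real \<Rightarrow> real \<Rightarrow> real" where
  "edge_rate a b \<delta> = (ln (1 + a / \<delta>) + ln (1 + b / \<delta>)) / 2"

text \<open>The two bounds meet because the crossing probabilities of the oscillating walk are also
  the largest possible ones, given \<open>\<delta> \<ge> 1\<close>.\<close>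

lemma rate_edge_measure:
  fixes E :: "'v::finite set set"
  assumes \<delta>: "\<delta> \<ge> 1" and sg: "simple_graph E" and adj: "adjacent E x y"
  shows "rate E \<delta> x (edge_measure x y) = ereal (edge_rate (degree E x - 1) (degree E y - 1) \<delta>)"
proof -
  have xy: "x \<noteq> y" by (rule simple_adjacent_neq[OF sg adj])
  have adj': "adjacent E y x" using adj adjacent_commute by metis
  have \<delta>0: "\<delta> > 0" using \<delta> by simp
  define a where "a = real (degree E x - 1)"
  define b where "b = real (degree E y - 1)"
  define p where "p = \<delta> / (\<delta> + a)"
  define q where "q = \<delta> / (\<delta> + b)"
  have ab: "a \<ge> 0" "b \<ge> 0" by (simp_all add: a_def b_def)
  have pq: "0 < p" "p \<le> 1" "0 < q" "q \<le> 1" using \<delta>0 ab by (auto simp: p_def q_def)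
  have tp: "trans_prob E \<delta> {{x, y}} x y = p" "trans_prob E \<delta> {{x, y}} y x = q"
    using trans_prob_single_edge[OF adj xy, of \<delta>] trans_prob_single_edge[OF adj' xy[symmetric], of \<delta>]
    by (simp_all add: p_def q_def a_def b_def insert_commute)
  have lnp: "- ln p = ln (1 + a / \<delta>)"
  proof -
    have "1 + a / \<delta> = inverse p" using \<delta>0 ab by (simp add: p_def field_simps)
    then show ?thesis using pq by (simp add: ln_inverse)
  qed
  have lnq: "- ln q = ln (1 + b / \<delta>)"
  proof -
    have "1 + b / \<delta> = inverse q" using \<delta>0 ab by (simp add: q_def field_simps)
    then show ?thesis using pq by (simp add: ln_inverse)
  qed
  let ?g = "edge_rate a b \<delta>"
  have g: "- ln (p * q) / 2 = ?g" using pq lnp lnq by (simp add: edge_rate_def ln_mult)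
  have ach: "achievable E \<delta> x (edge_measure x y) h" if "?g < h" for h
    using achievable_edge_measure[OF \<delta>0 adj xy, of h] that unfolding tp g by simp
  have low: "?g \<le> h" if "achievable E \<delta> x (edge_measure x y) h" for h
  \<comment> \<open>The lower bound needs \<rho> strictly above \<open>sqrt (p * q)\<close>; it is
    taken as \<open>exp (- r)\<close> with \<open>r\<close> just below the rate.\<close>
  proof (rule dense_le)
    fix r assume "r < ?g"
    then have "ln (sqrt (p * q)) < - r" using g pq by (simp add: ln_sqrt)
    then have lt: "sqrt (p * q) < exp (- r)"
      using pq by (metis exp_less_cancel_iff exp_ln mult_pos_pos real_sqrt_gt_zero)
    have "- ln (exp (- r)) \<le> h"
    proof (rule edge_measure_lower_bound[OF \<delta>0 sg xy pq _ _ lt that])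
      show "trans_prob E \<delta> A x y \<le> p" for A
        using trans_prob_le_single_edge[OF \<delta> adj, of A] by (simp add: p_def a_def)
      show "trans_prob E \<delta> A y x \<le> q" for A
        using trans_prob_le_single_edge[OF \<delta> adj', of A] by (simp add: q_def b_def)
    qed
    then show "r \<le> h" by simp
  qed
  have "rate E \<delta> x (edge_measure x y) = ereal ?g"
  proof (rule antisym)
    show "rate E \<delta> x (edge_measure x y) \<le> ereal ?g"
    proof (rule ereal_le_epsilon2)
      fix e :: real assume "0 < e"
      then show "rate E \<delta> x (edge_measure x y) \<le> ereal ?g + ereal e"
        using rate_le[OF ach[of "?g + e"]] by simp
    qed
    show "ereal ?g \<le> rate E \<delta> x (edge_measure x y)"
      unfolding rate_def by (rule Inf_greatest) (use low in auto)
  qed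
  then show ?thesis by (simp add: a_def b_def)
qed

section \<open>Degrees at the edge and the corner at \<delta> = 1\<close>

lemma connected_exists_adjacent:
  fixes E :: "'v::finite set set"
  assumes "connected_graph E" "CARD('v) \<ge> 3"
  obtains y where "adjacent E x y"
proof -
  have "UNIV \<noteq> {x}" using assms(2) by (metis card.empty card.insert empty_iff finite.emptyI numeral_le_one_iff One_nat_def semiring_norm(70))
  then obtain z where z: "z \<noteq> x" by blast
  have "(adjacent E)\<^sup>*\<^sup>* x z" using assms(1) by (simp add: connected_graph_def)
  then show ?thesis using z that by (metis converse_rtranclpE)
qed

text \<open>Otherwise the edge would be a whole connected component with two vertices. This makes
  the rate of the edge measure depend on \<delta>.\<close>

lemma degree_sum_ge_3:
  fixes E :: "'v::finite set set"
  assumes "connected_graph E" "CARD('v) \<ge> 3" "adjacent E x y"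
  shows "degree E x \<ge> 2 \<or> degree E y \<ge> 2"
proof (rule ccontr)
  assume "\<not> ?thesis"
  then have deg: "degree E x = 1" "degree E y = 1"
    using degree_pos[of E x y] degree_pos[of E y x] assms(3) adjacent_commute[of E x y] by auto
  have unique: "z = w" if d1: "degree E u = 1" and "adjacent E u z" "adjacent E u w" for u z w
  proof -
    obtain t where "{z. adjacent E u z} = {t}" using d1 unfolding degree_def by (rule card_1_singletonE)
    then have "z \<in> {t}" "w \<in> {t}" using that by blast+
    then show ?thesis by simp
  qed
  have nb: "\<And>z. adjacent E x z \<Longrightarrow> z = y" "\<And>z. adjacent E y z \<Longrightarrow> z = x"
    using unique deg assms(3) adjacent_commute[of E x y] by blast+
  have "z \<in> {x, y}" for z
  proof -
    have "(adjacent E)\<^sup>*\<^sup>* x z" using assms(1) by (simp add: connected_graph_def)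
    then show ?thesis by induction (use nb in blast)+
  qed
  then have "card (UNIV :: 'v set) \<le> card {x, y}" by (intro card_mono) auto
  also have "\<dots> \<le> 2" by (simp add: card_insert_if)
  finally show False using assms(2) by simp
qed

lemma edge_rate_strict_antimono:
  assumes "a \<ge> 0" "b \<ge> 0" "a + b > 0" "0 < \<delta>1" "\<delta>1 < \<delta>2"
  shows "edge_rate a b \<delta>2 < edge_rate a b \<delta>1"
proof -
  have less: "ln (1 + c / \<delta>2) < ln (1 + c / \<delta>1)" if "c > 0" for c
  proof -
    have "c / \<delta>2 < c / \<delta>1" using that assms by (intro divide_strict_left_mono mult_pos_pos) auto
    moreover have "0 \<le> c / \<delta>2" using that assms by simp
    ultimately show ?thesis by (subst ln_less_cancel_iff) auto
  qed
  then have le: "ln (1 + c / \<delta>2) \<le> ln (1 + c / \<delta>1)" if "c \<ge> 0" for c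
    using that by (cases "c = 0") (auto intro: less_imp_le)
  consider "a > 0" | "b > 0" using assms by linarith
  then show ?thesis
    using less le[OF assms(1)] le[OF assms(2)] by cases (force simp: edge_rate_def)+
qed

lemma edge_rate_derivative:
  assumes "a \<ge> 0" "b \<ge> 0"
  shows "(edge_rate a b has_real_derivative - (a / (1 + a) + b / (1 + b)) / 2) (at 1)"
proof -
  have "((\<lambda>\<delta>. ln (1 + c / \<delta>)) has_real_derivative - (c / (1 + c))) (at 1)" if "c \<ge> 0" for c
    using that by (auto intro!: derivative_eq_intros)
  from DERIV_cdivide[OF DERIV_add[OF this[OF assms(1)] this[OF assms(2)]], of 2]
  show ?thesis unfolding edge_rate_def[abs_def] by simp
qed

text \<open>A derivative at 1 would have to be both the left slope 0 and the right slope
  \<open>D\<close>.\<close>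

lemma not_differentiable_corner:
  fixes f g :: "real \<Rightarrow> real"
  assumes left: "\<And>x. 0 < x \<Longrightarrow> x \<le> 1 \<Longrightarrow> f x = f 1"
    and right: "\<And>x. 1 \<le> x \<Longrightarrow> f x = g x"
    and g: "(g has_real_derivative D) (at 1)" and D: "D \<noteq> 0"
  shows "\<not> f differentiable (at 1)"
proof
  assume "f differentiable (at 1)"
  then obtain D' where D': "(f has_real_derivative D') (at 1)"
    using real_differentiable_def by blast
  have lim: "((\<lambda>x. (f x - f 1) / (x - 1)) \<longlongrightarrow> D') (at_left 1)"
      "((\<lambda>x. (f x - f 1) / (x - 1)) \<longlongrightarrow> D') (at_right 1)"
    using has_field_derivative_at_within[OF D'] unfolding has_field_derivative_iff by blast+
  have "eventually (\<lambda>x. (f x - f 1) / (x - 1) = 0) (at_left 1)"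
    using eventually_at_left_real[of 0 1, OF zero_less_one]
  proof eventually_elim
    case (elim x)
    then show ?case using left[of x] by simp
  qed
  from Lim_transform_eventually[OF lim(1) this] have "D' = 0" by (simp add: tendsto_const_iff)
  have "((\<lambda>x. (g x - g 1) / (x - 1)) \<longlongrightarrow> D) (at_right 1)"
    using has_field_derivative_at_within[OF g] unfolding has_field_derivative_iff by blast
  moreover have "eventually (\<lambda>x. (g x - g 1) / (x - 1) = (f x - f 1) / (x - 1)) (at_right 1)"
    using eventually_at_right_less[of 1]
  proof eventually_elim
    case (elim x)
    then show ?case using right[of x] right[of 1] by simp
  qed
  ultimately have "((\<lambda>x. (f x - f 1) / (x - 1)) \<longlongrightarrow> D) (at_right 1)"
    by (rule Lim_transform_eventually)
  from tendsto_unique[OF _ this lim(2)] have "D = D'" by simp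
  then show False using D \<open>D' = 0\<close> by simp
qed

theorem theorem1p1:
  fixes E :: "'v::finite set set" and x0 :: 'v
    and M :: "real \<Rightarrow> 'm measure" and X :: "real \<Rightarrow> nat \<Rightarrow> 'm \<Rightarrow> 'v"
  assumes "simple_graph E" and "connected_graph E" and "CARD('v) \<ge> 3"
    and "\<And>\<delta>. \<delta> > 0 \<Longrightarrow> orrw E \<delta> x0 (M \<delta>) (X \<delta>)"
  shows "\<exists>I :: real \<Rightarrow> 'v pmf \<Rightarrow> ereal.
    (\<forall>\<delta>>0. good_rate_function weak_topology (I \<delta>) \<and>
            satisfies_LDP weak_topology (M \<delta>) (empirical_measure (X \<delta>)) (I \<delta>)) \<and>
    (\<forall>\<nu>. continuous_on {1..} (\<lambda>\<delta>. I \<delta> \<nu>) \<and>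
          (\<forall>\<delta>1 \<delta>2. 1 \<le> \<delta>1 \<and> \<delta>1 < \<delta>2 \<longrightarrow> I \<delta>1 \<nu> \<ge> I \<delta>2 \<nu>) \<and>
          (\<forall>\<delta>1\<in>{0<..1}. \<forall>\<delta>2\<in>{0<..1}. I \<delta>1 \<nu> = I \<delta>2 \<nu>)) \<and>
    (\<exists>\<nu>. (\<forall>\<delta>>0. I \<delta> \<nu> < \<infinity>) \<and>
          \<not> (\<lambda>\<delta>. real_of_ereal (I \<delta> \<nu>)) differentiable (at 1)) \<and>
    (\<forall>\<delta>1 \<delta>2. 1 \<le> \<delta>1 \<and> \<delta>1 < \<delta>2 \<longrightarrow> I \<delta>1 \<noteq> I \<delta>2)"
proof -
  \<comment> \<open>An edge at \<open>x0\<close> can be used from the start with no other edge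
    traversed, the best situation for crossing it when \<open>\<delta> \<ge> 1\<close>.\<close>
  obtain y where adj: "adjacent E x0 y" using connected_exists_adjacent[OF assms(2,3)] .
  define a where "a = real (degree E x0 - 1)"
  define b where "b = real (degree E y - 1)"
  have ab: "a \<ge> 0" "b \<ge> 0" "a + b > 0"
    using degree_sum_ge_3[OF assms(2,3) adj] by (auto simp: a_def b_def)
  define \<nu> where "\<nu> = edge_measure x0 y"
  let ?I = "\<lambda>\<delta>. rate E \<delta> x0"
  have edge: "?I \<delta> \<nu> = ereal (edge_rate a b \<delta>)" if "\<delta> \<ge> 1" for \<delta>
    using rate_edge_measure[OF that assms(1) adj] by (simp add: \<nu>_def a_def b_def)
  have const: "?I \<delta> \<mu> = ?I 1 \<mu>" if "0 < \<delta>" "\<delta> \<le> 1" for \<delta> \<mu>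
    by (rule rate_eq_rate_1[OF that assms(1,2)])
  \<comment> \<open>Finiteness for every positive \<delta> makes \<open>real_of_ereal\<close>
    faithful around 1, so the failing derivative is not an artefact of the conversion.\<close>
  have finite: "?I \<delta> \<nu> < \<infinity>" if "\<delta> > 0" for \<delta>
    using edge[of \<delta>] edge[of 1] const[of \<delta> \<nu>] that by (cases "\<delta> \<ge> 1") auto
  have LDP: "good_rate_function weak_topology (?I \<delta>) \<and>
      satisfies_LDP weak_topology (M \<delta>) (empirical_measure (X \<delta>)) (?I \<delta>)" if "\<delta> > 0" for \<delta>
  proof -
    interpret orrw_process E \<delta> x0 "M \<delta>" "X \<delta>"
      using assms(4)[OF that] that by unfold_locales
    show ?thesis using satisfies_LDP_rate rate_good[OF that] finite[OF that] by blast
  qed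
  have corner: "\<not> (\<lambda>\<delta>. real_of_ereal (?I \<delta> \<nu>)) differentiable (at 1)"
  proof (rule not_differentiable_corner)
    show "(edge_rate a b has_real_derivative - (a / (1 + a) + b / (1 + b)) / 2) (at 1)"
      by (rule edge_rate_derivative[OF ab(1,2)])
    have "a / (1 + a) + b / (1 + b) > 0"
      using ab by (cases "a = 0") (auto intro!: add_pos_nonneg divide_pos_pos)
    then show "- (a / (1 + a) + b / (1 + b)) / 2 \<noteq> 0" by simp
    show "real_of_ereal (?I \<delta> \<nu>) = real_of_ereal (?I 1 \<nu>)" if "0 < \<delta>" "\<delta> \<le> 1" for \<delta>
      by (simp only: const[OF that])
    show "real_of_ereal (?I \<delta> \<nu>) = edge_rate a b \<delta>" if "1 \<le> \<delta>" for \<delta>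
      by (simp add: edge[OF that])
  qed
  have strict: "?I \<delta>1 \<noteq> ?I \<delta>2" if "1 \<le> \<delta>1" "\<delta>1 < \<delta>2" for \<delta>1 \<delta>2
  proof
    assume "?I \<delta>1 = ?I \<delta>2"
    then have "edge_rate a b \<delta>1 = edge_rate a b \<delta>2" using edge[of \<delta>1] edge[of \<delta>2] that by simp
    then show False using edge_rate_strict_antimono[OF ab, of \<delta>1 \<delta>2] that by simp
  qed
  show ?thesis
  proof (intro exI[of _ ?I] conjI allI impI ballI)
    show "?I \<delta>1 \<mu> = ?I \<delta>2 \<mu>" if "\<delta>1 \<in> {0<..1}" "\<delta>2 \<in> {0<..1}" for \<delta>1 \<delta>2 \<mu>
      using const[of \<delta>1 \<mu>] const[of \<delta>2 \<mu>] that by simp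
    show "\<exists>\<nu>. (\<forall>\<delta>>0. ?I \<delta> \<nu> < \<infinity>) \<and> \<not> (\<lambda>\<delta>. real_of_ereal (?I \<delta> \<nu>)) differentiable (at 1)"
      using finite corner by blast
    show "good_rate_function weak_topology (?I \<delta>)"
      "satisfies_LDP weak_topology (M \<delta>) (empirical_measure (X \<delta>)) (?I \<delta>)" if "0 < \<delta>" for \<delta>
      using LDP[OF that] by blast+
    show "continuous_on {1..} (\<lambda>\<delta>. ?I \<delta> \<mu>)" for \<mu> by (rule rate_continuous_on)
    show "?I \<delta>1 \<mu> \<ge> ?I \<delta>2 \<mu>" if "1 \<le> \<delta>1 \<and> \<delta>1 < \<delta>2" for \<delta>1 \<delta>2 \<mu>
      using that by (intro rate_antimono) auto
    show "?I \<delta>1 \<noteq> ?I \<delta>2" if "1 \<le> \<delta>1 \<and> \<delta>1 < \<delta>2" for \<delta>1 \<delta>2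
      using that strict by blast
  qed
qed

end
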